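(* Let $\Gamma$ be a finite simplicial graph on vertex set $\mathsf{V}$ with $|\mathsf{V}|>1$, let $G_\Gamma$ be the associated right-angled Artin group, let $\chi\colon G_\Gamma\twoheadrightarrow\mathbb{Z}$ be an epimorphism, $N_\chi=\ker(\chi)$, and $\iota\colon N_\chi\hookrightarrow G_\Gamma$ the inclusion, with induced map $\iota^*\colon H^1(G_\Gamma,\mathbb{R})=\mathbb{R}^{\mathsf{V}}\to H^1(N_\chi,\mathbb{R})$. Suppose $H_1(N_\chi,\mathbb{Q})$ has trivial $\mathbb{Q}\mathbb{Z}$-action. Then $$\Sigma^1(N_\chi)\subseteq\Big(\bigcup_{\mathsf{W}}\iota^*\big(\mathbb{R}^{\mathsf{W}}\big)\Big)^{c},$$ where $\mathsf{W}$ runs through all subsets of $\mathsf{V}$ such that the induced subgraph $\Gamma_{\mathsf{W}}$ is disconnected, and $(\cdot)^c$ denotes the complement in $H^1(N_\chi,\mathbb{R})$. If, in addition, $H_2(N_\chi,\mathbb{Q})$ has trivial $\mathbb{Q}\mathbb{Z}$-action, then this upper bound coincides with $\mathcal{R}^1_1(N_\chi,\mathbb{R})^{c}$.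
   Context: $G_\Gamma$ has a generator $v$ for each $v\in\mathsf{V}$ and a relation $vw=wv$ for each edge $\{v,w\}$ of $\Gamma$. $\mathbb{R}^{\mathsf{V}}$ has basis dual to $\mathsf{V}$, and $\mathbb{R}^{\mathsf{W}}$ is the coordinate subspace spanned by the duals of the elements of $\mathsf{W}$. $\Gamma_{\mathsf{W}}$ is the subgraph induced by $\Gamma$ on $\mathsf{W}$. $\mathbb{Q}\mathbb{Z}$ is the group ring of $\mathbb{Z}=G_\Gamma/N_\chi$, acting on $H_*(N_\chi,\mathbb{Q})$ through conjugation by $G_\Gamma$. If the action on $H_1(N_\chi,\mathbb{Q})$ is trivial, it is known that $N_\chi$ is finitely generated. For a finitely generated group $G$, fix a finite generating set with Cayley graph $\mathcal{C}(G)$; $\Sigma^1(G)$ (the Bieri–Neumann–Strebel invariant) is the set of non-zero homomorphisms $\chi'\colon G\to\mathbb{R}$ for which the full subgraph of $\mathcal{C}(G)$ on $\{g\in G\mid\chi'(g)\ge0\}$ is connected (it is independent of the generating set); it is a subset of $\operatorname{Hom}(G,\mathbb{R})=H^1(G,\mathbb{R})$. With $A=H^*(G,\mathbb{R})$, $\mathcal{R}^1_1(G,\mathbb{R})=\{a\in A^1\mid H^1(A,\cdot a)\ne0\}$, where $(A,\cdot a)$ is the cochain complex $A^0\to A^1\to A^2\to\cdots$ with differential right-multiplication by $a$. *)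

theory Defs
  imports
    Complex_Main
    "HOL-Library.Poly_Mapping"
    "HOL-Algebra.Coset"
    "HOL-Algebra.Generated_Groups"
    "HOL-Algebra.Elementary_Groups"
    "Graph_Theory.Graph_Theory"
begin

section \<open>Presented groups and right-angled Artin groups\<close>

text \<open>A letter \<open>(x, True)\<close> stands for the generator \<open>x\<close>, and \<open>(x, False)\<close> for its inverse.\<close>

type_synonym 'x word = "('x \<times> bool) list"

definition words :: "'x set \<Rightarrow> 'x word set" where
  "words X = {w. fst ` set w \<subseteq> X}"

inductive_set pres_rel :: "'x set \<Rightarrow> ('x word \<times> 'x word) set \<Rightarrow> ('x word \<times> 'x word) set"
  for X :: "'x set" and R :: "('x word \<times> 'x word) set" where
  refl: "w \<in> words X \<Longrightarrow> (w, w) \<in> pres_rel X R"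
| sym: "(u, w) \<in> pres_rel X R \<Longrightarrow> (w, u) \<in> pres_rel X R"
| trans: "(u, v) \<in> pres_rel X R \<Longrightarrow> (v, w) \<in> pres_rel X R \<Longrightarrow> (u, w) \<in> pres_rel X R"
| append: "(u, w) \<in> pres_rel X R \<Longrightarrow> (u', w') \<in> pres_rel X R \<Longrightarrow> (u @ u', w @ w') \<in> pres_rel X R"
| cancel: "x \<in> X \<Longrightarrow> ([(x, b), (x, \<not> b)], []) \<in> pres_rel X R"
| relation: "(u, w) \<in> R \<Longrightarrow> u \<in> words X \<Longrightarrow> w \<in> words X \<Longrightarrow> (u, w) \<in> pres_rel X R"

definition presented_group :: "'x set \<Rightarrow> ('x word \<times> 'x word) set \<Rightarrow> 'x word set monoid" where
  "presented_group X R =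
    \<lparr>carrier = words X // pres_rel X R,
     monoid.mult = (\<lambda>P Q. \<Union>u\<in>P. \<Union>w\<in>Q. pres_rel X R `` {u @ w}),
     one = pres_rel X R `` {[]}\<rparr>"

text \<open>A finite simplicial graph is a \<^term>\<open>pair_graph\<close>: an edge \<open>{v, w}\<close> is the pair of
  arcs \<open>(v, w)\<close> and \<open>(w, v)\<close>.\<close>

definition raag :: "'v pair_pre_digraph \<Rightarrow> 'v word set monoid" where
  "raag \<Gamma> = presented_group (pverts \<Gamma>)
     {([(v, True), (w, True)], [(w, True), (v, True)]) | v w. (v, w) \<in> parcs \<Gamma>}"

text \<open>The group \<open>N\<^sub>\<chi>\<close>, with the operation inherited from \<open>G\<close>.\<close>

definition kernel_group :: "('a, 'm) monoid_scheme \<Rightarrow> ('a \<Rightarrow> int) \<Rightarrow> ('a, 'm) monoid_scheme" where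
  "kernel_group G \<chi> = G\<lparr>carrier := kernel G integer_group \<chi>\<rparr>"

section \<open>Group homology with rational coefficients\<close>

text \<open>Homology and cohomology are those of the (unnormalised) bar complex; a list
  \<open>[g\<^sub>1, \<dots>, g\<^sub>n]\<close> stands for the bar generator \<open>[g\<^sub>1|\<dots>|g\<^sub>n]\<close>.\<close>

definition tuples :: "('a, 'm) monoid_scheme \<Rightarrow> nat \<Rightarrow> 'a list set" where
  "tuples G n = {xs. length xs = n \<and> set xs \<subseteq> carrier G}"

definition bar_face :: "('a, 'm) monoid_scheme \<Rightarrow> nat \<Rightarrow> 'a list \<Rightarrow> 'a list" where
  "bar_face G i xs =
    (if i = 0 then tl xs
     else if i = length xs then butlast xs
     else take (i - 1) xs @ (xs ! (i - 1) \<otimes>\<^bsub>G\<^esub> xs ! i) # drop (i + 1) xs)"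

definition bar_chains :: "('a, 'm) monoid_scheme \<Rightarrow> nat \<Rightarrow> ('a list \<Rightarrow>\<^sub>0 rat) monoid" where
  "bar_chains G n = \<lparr>carrier = {c. Poly_Mapping.keys c \<subseteq> tuples G n}, monoid.mult = (+), one = 0\<rparr>"

definition bar_boundary ::
    "('a, 'm) monoid_scheme \<Rightarrow> nat \<Rightarrow> ('a list \<Rightarrow>\<^sub>0 rat) \<Rightarrow> ('a list \<Rightarrow>\<^sub>0 rat)" where
  "bar_boundary G n c =
    (if n = 0 then 0
     else \<Sum>xs\<in>Poly_Mapping.keys c. \<Sum>i\<le>n.
       Poly_Mapping.single (bar_face G i xs) ((-1) ^ i * Poly_Mapping.lookup c xs))"

definition bar_cycles :: "('a, 'm) monoid_scheme \<Rightarrow> nat \<Rightarrow> ('a list \<Rightarrow>\<^sub>0 rat) set" where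
  "bar_cycles G n = {c \<in> carrier (bar_chains G n). bar_boundary G n c = 0}"

definition bar_boundaries :: "('a, 'm) monoid_scheme \<Rightarrow> nat \<Rightarrow> ('a list \<Rightarrow>\<^sub>0 rat) set" where
  "bar_boundaries G n = bar_boundary G (Suc n) ` carrier (bar_chains G (Suc n))"

definition group_homology ::
    "('a, 'm) monoid_scheme \<Rightarrow> nat \<Rightarrow> ('a list \<Rightarrow>\<^sub>0 rat) set monoid" where
  "group_homology G n = (bar_chains G n)\<lparr>carrier := bar_cycles G n\<rparr> Mod bar_boundaries G n"

definition bar_push :: "('a \<Rightarrow> 'b) \<Rightarrow> ('a list \<Rightarrow>\<^sub>0 rat) \<Rightarrow> ('b list \<Rightarrow>\<^sub>0 rat)" where
  "bar_push f c =
    (\<Sum>xs\<in>Poly_Mapping.keys c. Poly_Mapping.single (map f xs) (Poly_Mapping.lookup c xs))"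

text \<open>The map \<open>f\<^sub>*\<close> on homology induced by a homomorphism \<open>f\<close> to the group \<open>H\<close>. As in
  the multiplication of a factor group, the union is over representatives of the class \<open>X\<close>,
  all of which give the same coset.\<close>

definition homology_map ::
    "('b, 'm) monoid_scheme \<Rightarrow> nat \<Rightarrow> ('a \<Rightarrow> 'b) \<Rightarrow>
      ('a list \<Rightarrow>\<^sub>0 rat) set \<Rightarrow> ('b list \<Rightarrow>\<^sub>0 rat) set" where
  "homology_map H n f X =
    (\<Union>c\<in>X. bar_boundaries H n #>\<^bsub>bar_chains H n\<^esub> bar_push f c)"

text \<open>For \<open>N\<close> normal in \<open>G\<close>, the rational group ring of \<open>G/N\<close> acts on the homology of \<open>N\<close>
  through conjugation by \<open>G\<close>; the action is trivial iff every group element acts as the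
  identity.\<close>

definition trivial_conj_action :: "('a, 'm) monoid_scheme \<Rightarrow> 'a set \<Rightarrow> nat \<Rightarrow> bool" where
  "trivial_conj_action G N n \<longleftrightarrow>
    (\<forall>g\<in>carrier G. \<forall>X\<in>carrier (group_homology (G\<lparr>carrier := N\<rparr>) n).
       homology_map (G\<lparr>carrier := N\<rparr>) n (\<lambda>x. g \<otimes>\<^bsub>G\<^esub> x \<otimes>\<^bsub>G\<^esub> inv\<^bsub>G\<^esub> g) X = X)"

section \<open>Group cohomology with real coefficients\<close>

text \<open>Cochains are functions on all lists that vanish off the \<open>n\<close>-tuples of group elements.\<close>

definition bar_cochains :: "('a, 'm) monoid_scheme \<Rightarrow> nat \<Rightarrow> ('a list \<Rightarrow> real) monoid" where
  "bar_cochains G n =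
    \<lparr>carrier = {f. \<forall>xs. xs \<notin> tuples G n \<longrightarrow> f xs = 0},
     monoid.mult = (\<lambda>f h xs. f xs + h xs), one = (\<lambda>xs. 0)\<rparr>"

definition bar_coboundary ::
    "('a, 'm) monoid_scheme \<Rightarrow> nat \<Rightarrow> ('a list \<Rightarrow> real) \<Rightarrow> ('a list \<Rightarrow> real)" where
  "bar_coboundary G n f =
    (\<lambda>xs. if xs \<in> tuples G (Suc n) then \<Sum>i\<le>Suc n. (-1) ^ i * f (bar_face G i xs) else 0)"

definition bar_cocycles :: "('a, 'm) monoid_scheme \<Rightarrow> nat \<Rightarrow> ('a list \<Rightarrow> real) set" where
  "bar_cocycles G n = {f \<in> carrier (bar_cochains G n). bar_coboundary G n f = (\<lambda>xs. 0)}"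

definition bar_coboundaries :: "('a, 'm) monoid_scheme \<Rightarrow> nat \<Rightarrow> ('a list \<Rightarrow> real) set" where
  "bar_coboundaries G n =
    (if n = 0 then {\<lambda>xs. 0}
     else bar_coboundary G (n - 1) ` carrier (bar_cochains G (n - 1)))"

definition group_cohomology ::
    "('a, 'm) monoid_scheme \<Rightarrow> nat \<Rightarrow> ('a list \<Rightarrow> real) set monoid" where
  "group_cohomology G n =
    (bar_cochains G n)\<lparr>carrier := bar_cocycles G n\<rparr> Mod bar_coboundaries G n"

definition coh_class ::
    "('a, 'm) monoid_scheme \<Rightarrow> nat \<Rightarrow> ('a list \<Rightarrow> real) \<Rightarrow> ('a list \<Rightarrow> real) set" where
  "coh_class G n f = bar_coboundaries G n #>\<^bsub>bar_cochains G n\<^esub> f"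

text \<open>The map \<open>f\<^sup>*\<close> on cohomology induced by a homomorphism \<open>f\<close> from the group \<open>G\<close>.\<close>

definition cohomology_map ::
    "('a, 'm) monoid_scheme \<Rightarrow> nat \<Rightarrow> ('a \<Rightarrow> 'b) \<Rightarrow>
      ('b list \<Rightarrow> real) set \<Rightarrow> ('a list \<Rightarrow> real) set" where
  "cohomology_map G n f X =
    (\<Union>c\<in>X. coh_class G n (\<lambda>xs. if xs \<in> tuples G n then c (map f xs) else 0))"

definition cup_cochain ::
    "('a, 'm) monoid_scheme \<Rightarrow> nat \<Rightarrow> nat \<Rightarrow>
      ('a list \<Rightarrow> real) \<Rightarrow> ('a list \<Rightarrow> real) \<Rightarrow> ('a list \<Rightarrow> real)" where
  "cup_cochain G p q f h =
    (\<lambda>xs. if xs \<in> tuples G (p + q) then f (take p xs) * h (drop p xs) else 0)"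

definition cup ::
    "('a, 'm) monoid_scheme \<Rightarrow> nat \<Rightarrow> nat \<Rightarrow>
      ('a list \<Rightarrow> real) set \<Rightarrow> ('a list \<Rightarrow> real) set \<Rightarrow> ('a list \<Rightarrow> real) set" where
  "cup G p q X Y = (\<Union>f\<in>X. \<Union>h\<in>Y. coh_class G (p + q) (cup_cochain G p q f h))"

section \<open>The first resonance variety\<close>

text \<open>\<open>H\<^sup>i(A, \<cdot>a)\<close> for \<open>A = H\<^sup>*(G, \<real>)\<close> and \<open>a \<in> A\<^sup>1\<close>.\<close>

definition aomoto_cohomology ::
    "('a, 'm) monoid_scheme \<Rightarrow> nat \<Rightarrow> ('a list \<Rightarrow> real) set \<Rightarrow>
      ('a list \<Rightarrow> real) set set monoid" where
  "aomoto_cohomology G i a =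
    (group_cohomology G i)
      \<lparr>carrier := {b \<in> carrier (group_cohomology G i).
                     cup G i 1 b a = \<one>\<^bsub>group_cohomology G (i + 1)\<^esub>}\<rparr>
    Mod (if i = 0 then {\<one>\<^bsub>group_cohomology G 0\<^esub>}
         else (\<lambda>c. cup G (i - 1) 1 c a) ` carrier (group_cohomology G (i - 1)))"

definition resonance11 :: "('a, 'm) monoid_scheme \<Rightarrow> ('a list \<Rightarrow> real) set set" where
  "resonance11 G =
    {a \<in> carrier (group_cohomology G 1).
       carrier (aomoto_cohomology G 1 a) \<noteq> {\<one>\<^bsub>aomoto_cohomology G 1 a\<^esub>}}"

section \<open>The Bieri--Neumann--Strebel invariant\<close>

definition real_group :: "real monoid" where
  "real_group = \<lparr>carrier = UNIV, monoid.mult = (+), one = 0\<rparr>"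

text \<open>The identification of homomorphisms to \<open>\<real>\<close> with classes in \<open>H\<^sup>1(G, \<real>)\<close>.\<close>

definition hom_class :: "('a, 'm) monoid_scheme \<Rightarrow> ('a \<Rightarrow> real) \<Rightarrow> ('a list \<Rightarrow> real) set" where
  "hom_class G \<phi> = coh_class G 1 (\<lambda>xs. if xs \<in> tuples G 1 then \<phi> (hd xs) else 0)"

definition cayley_graph :: "('a, 'm) monoid_scheme \<Rightarrow> 'a set \<Rightarrow> 'a pair_pre_digraph" where
  "cayley_graph G S =
    \<lparr>pverts = carrier G, parcs = {(g, g \<otimes>\<^bsub>G\<^esub> s) | g s. g \<in> carrier G \<and> s \<in> S}\<rparr>"

definition finite_generating_set :: "('a, 'm) monoid_scheme \<Rightarrow> 'a set \<Rightarrow> bool" where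
  "finite_generating_set G S \<longleftrightarrow> finite S \<and> S \<subseteq> carrier G \<and> generate G S = carrier G"

text \<open>Connectedness of the half-space does not depend on the finite generating set \<open>S\<close>, so
  quantifying \<open>S\<close> existentially amounts to fixing one. \<^const>\<open>Digraph_Component.connected\<close>
  ignores the direction of arcs.\<close>

definition bns1 :: "('a, 'm) monoid_scheme \<Rightarrow> ('a list \<Rightarrow> real) set set" where
  "bns1 G =
    {hom_class G \<phi> | \<phi>. \<phi> \<in> hom G real_group \<and> (\<exists>g\<in>carrier G. \<phi> g \<noteq> 0) \<and>
       (\<exists>S. finite_generating_set G S \<and>
          Digraph_Component.connected
            (induce_subgraph (with_proj (cayley_graph G S)) {g \<in> carrier G. \<phi> g \<ge> 0}))}"

section \<open>Coordinate subspaces\<close>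

definition exponent_sum :: "'x \<Rightarrow> 'x word \<Rightarrow> real" where
  "exponent_sum x w = (\<Sum>(y, b)\<leftarrow>w. if y = x then (if b then 1 else -1) else 0)"

text \<open>The exponent sum of \<open>v\<close> is constant on the classes of words making up a right-angled
  Artin group.\<close>

definition vertex_dual :: "'v \<Rightarrow> 'v word set \<Rightarrow> real" where
  "vertex_dual v P = the_elem (exponent_sum v ` P)"

definition coord_subspace ::
    "'v pair_pre_digraph \<Rightarrow> 'v set \<Rightarrow> ('v word set list \<Rightarrow> real) set set" where
  "coord_subspace \<Gamma> W = {hom_class (raag \<Gamma>) (\<lambda>g. \<Sum>v\<in>W. c v * vertex_dual v g) | c. True}"

text \<open>\<^const>\<open>Digraph_Component.connected\<close> requires a nonempty vertex set, so the empty set is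
  among the \<open>W\<close> below and contributes the zero class.\<close>

definition disconnected_subsets :: "'v pair_pre_digraph \<Rightarrow> 'v set set" where
  "disconnected_subsets \<Gamma> =
    {W. W \<subseteq> pverts \<Gamma> \<and> \<not> Digraph_Component.connected (induce_subgraph (with_proj \<Gamma>) W)}"

end

theory Submission
  imports Defs "HOL-Computational_Algebra.Fundamental_Theorem_Algebra"
begin

text \<open>Let \<open>\<psi>\<close> be a character supported on a disconnected set \<open>W1 \<union> W2\<close>. The group \<open>G\<close> acts on two
  copies of the real line, glued along a wall that only letters of \<open>W2\<close> feel, and \<open>g\<close> translates by
  \<open>\<psi> g\<close>. Paths in the half-space of \<open>N\<close> stay far from the wall and keep the sheet, but a
  commutator of letters of \<open>W1\<close> and \<open>W2\<close> changes it, so \<open>\<psi>\<close> is not in \<open>\<Sigma>\<^sup>1(N)\<close>.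

  If \<open>H\<^sub>1(N)\<close> is a trivial module, every character of \<open>N\<close> extends to \<open>G\<close>, only multiples of \<open>\<chi>\<close>
  annihilate \<open>\<chi>\<close>, and \<open>a \<union> b\<close> vanishes on \<open>N\<close> iff \<open>a \<union> b = \<chi> \<union> c\<close> on \<open>G\<close> for some \<open>c\<close>. If
  \<open>H\<^sub>2(N)\<close> is trivial as well, comparing the Massey product \<open>\<langle>a, a, b\<rangle>\<close> on \<open>N\<close> with its conjugate
  shows that \<open>a \<union> c\<close> vanishes on \<open>N\<close> too. So \<open>b \<mapsto> c\<close> can be iterated; an eigenvector for an
  eigenvalue \<open>z\<close> modulo \<open>a\<close> and \<open>\<chi>\<close> is annihilated by \<open>a - z\<chi>\<close>, whose support then lies in a
  disconnected set. That set misses a vertex where \<open>\<chi>\<close> is nonzero, hence \<open>z\<close> is real, and \<open>a - z\<chi>\<close>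
  has the same restriction to \<open>N\<close> as \<open>a\<close>.\<close>

section \<open>Right-angled Artin groups\<close>

definition raag_relators :: "'v pair_pre_digraph \<Rightarrow> ('v word \<times> 'v word) set" where
  "raag_relators \<Gamma> = {([(v, True), (w, True)], [(w, True), (v, True)]) | v w. (v, w) \<in> parcs \<Gamma>}"

definition raag_class :: "'v pair_pre_digraph \<Rightarrow> 'v word \<Rightarrow> 'v word set" where
  "raag_class \<Gamma> w = pres_rel (pverts \<Gamma>) (raag_relators \<Gamma>) `` {w}"

abbreviation gen :: "'v pair_pre_digraph \<Rightarrow> 'v \<Rightarrow> 'v word set" where
  "gen \<Gamma> v \<equiv> raag_class \<Gamma> [(v, True)]"

definition inv_word :: "'x word \<Rightarrow> 'x word" where
  "inv_word w = map (\<lambda>(x, b). (x, \<not> b)) (rev w)"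

lemma words_Nil [simp]: "[] \<in> words X"
  and words_Cons [simp]: "(x, b) # w \<in> words X \<longleftrightarrow> x \<in> X \<and> w \<in> words X"
  and words_append [simp]: "u @ w \<in> words X \<longleftrightarrow> u \<in> words X \<and> w \<in> words X"
  by (auto simp: words_def)

lemma inv_word_in_words [simp]: "inv_word w \<in> words X \<longleftrightarrow> w \<in> words X"
  by (force simp: inv_word_def words_def)

lemma inv_word_simps [simp]: "inv_word [] = []" "inv_word ((x, b) # w) = inv_word w @ [(x, \<not> b)]"
  by (auto simp: inv_word_def)

lemma pres_rel_words: "(u, w) \<in> pres_rel X R \<Longrightarrow> u \<in> words X \<and> w \<in> words X"
  by (induction rule: pres_rel.induct) auto

lemma equiv_pres_rel: "equiv (words X) (pres_rel X R)"
proof (rule equivI)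
  show "pres_rel X R \<subseteq> words X \<times> words X" using pres_rel_words by auto
  show "refl_on (words X) (pres_rel X R)" by (auto simp: refl_on_def intro: pres_rel.refl)
  show "Relation.sym (pres_rel X R)" by (auto simp: Relation.sym_def intro: pres_rel.sym)
  show "Relation.trans (pres_rel X R)" by (auto simp: Relation.trans_def intro: pres_rel.trans)
qed

lemma pres_rel_inv_word:
  "w \<in> words X \<Longrightarrow> (inv_word w @ w, []) \<in> pres_rel X R"
proof (induction w)
  case Nil
  then show ?case by (auto intro: pres_rel.refl)
next
  case (Cons a w)
  obtain x b where a: "a = (x, b)" by force
  have "([(x, \<not> b), (x, \<not> \<not> b)], []) \<in> pres_rel X R"
    using Cons.prems a by (intro pres_rel.cancel) auto
  then have "([(x, \<not> b), (x, b)] @ w, [] @ w) \<in> pres_rel X R"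
    using Cons.prems a by (intro pres_rel.append) (auto intro: pres_rel.refl simp del: append.simps)
  then have "(inv_word w @ [(x, \<not> b), (x, b)] @ w, inv_word w @ [] @ w) \<in> pres_rel X R"
    using Cons.prems a by (intro pres_rel.append[OF pres_rel.refl]) auto
  moreover have "(inv_word w @ w, []) \<in> pres_rel X R" using Cons a by auto
  ultimately show ?case using a by (auto intro: pres_rel.trans)
qed

lemma raag_carrier: "carrier (raag \<Gamma>) = raag_class \<Gamma> ` words (pverts \<Gamma>)"
  by (auto simp: raag_def presented_group_def raag_class_def raag_relators_def quotient_def)

lemma raag_one: "\<one>\<^bsub>raag \<Gamma>\<^esub> = raag_class \<Gamma> []"
  by (simp add: raag_def presented_group_def raag_class_def raag_relators_def)

lemma raag_class_eq_iff:
  "u \<in> words (pverts \<Gamma>) \<Longrightarrow> w \<in> words (pverts \<Gamma>) \<Longrightarrow>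
    raag_class \<Gamma> u = raag_class \<Gamma> w \<longleftrightarrow> (u, w) \<in> pres_rel (pverts \<Gamma>) (raag_relators \<Gamma>)"
  unfolding raag_class_def by (rule eq_equiv_class_iff[OF equiv_pres_rel])

lemma raag_mult:
  assumes "u \<in> words (pverts \<Gamma>)" "w \<in> words (pverts \<Gamma>)"
  shows "raag_class \<Gamma> u \<otimes>\<^bsub>raag \<Gamma>\<^esub> raag_class \<Gamma> w = raag_class \<Gamma> (u @ w)"
proof -
  let ?r = "pres_rel (pverts \<Gamma>) (raag_relators \<Gamma>)"
  have "raag_class \<Gamma> u \<otimes>\<^bsub>raag \<Gamma>\<^esub> raag_class \<Gamma> w = (\<Union>p\<in>?r``{u}. \<Union>q\<in>?r``{w}. ?r `` {p @ q})"
    by (simp add: raag_def presented_group_def raag_class_def raag_relators_def)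
  also have "\<dots> = ?r `` {u @ w}"
  proof -
    have "?r `` {p @ q} = ?r `` {u @ w}" if "(u, p) \<in> ?r" "(w, q) \<in> ?r" for p q
      using equiv_class_eq[OF equiv_pres_rel pres_rel.append[OF that]] by simp
    moreover have "(u, u) \<in> ?r" "(w, w) \<in> ?r" using assms by (auto intro: pres_rel.refl)
    ultimately show ?thesis by blast
  qed
  finally show ?thesis by (simp add: raag_class_def)
qed

lemma raag_class_closed [simp]: "w \<in> words (pverts \<Gamma>) \<Longrightarrow> raag_class \<Gamma> w \<in> carrier (raag \<Gamma>)"
  by (simp add: raag_carrier)

lemma raag_inv_mult:
  "w \<in> words (pverts \<Gamma>) \<Longrightarrow> raag_class \<Gamma> (inv_word w) \<otimes>\<^bsub>raag \<Gamma>\<^esub> raag_class \<Gamma> w = \<one>\<^bsub>raag \<Gamma>\<^esub>"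
  by (simp add: raag_mult raag_one raag_class_eq_iff pres_rel_inv_word)

lemma group_raag: "group (raag \<Gamma>)"
proof (rule groupI)
  fix x assume "x \<in> carrier (raag \<Gamma>)"
  then obtain w where w: "w \<in> words (pverts \<Gamma>)" "x = raag_class \<Gamma> w" by (auto simp: raag_carrier)
  then show "\<exists>y\<in>carrier (raag \<Gamma>). y \<otimes>\<^bsub>raag \<Gamma>\<^esub> x = \<one>\<^bsub>raag \<Gamma>\<^esub>"
    using raag_inv_mult by (intro bexI[of _ "raag_class \<Gamma> (inv_word w)"]) auto
qed (auto simp: raag_carrier raag_mult raag_one)

lemma raag_inv:
  "w \<in> words (pverts \<Gamma>) \<Longrightarrow> inv\<^bsub>raag \<Gamma>\<^esub> (raag_class \<Gamma> w) = raag_class \<Gamma> (inv_word w)"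
  by (rule group.inv_equality[OF group_raag raag_inv_mult]) simp_all

lemma raag_arc_commute:
  assumes "(v, w) \<in> parcs \<Gamma>" "v \<in> pverts \<Gamma>" "w \<in> pverts \<Gamma>"
  shows "gen \<Gamma> v \<otimes>\<^bsub>raag \<Gamma>\<^esub> gen \<Gamma> w = gen \<Gamma> w \<otimes>\<^bsub>raag \<Gamma>\<^esub> gen \<Gamma> v"
  using assms by (auto simp: raag_mult raag_class_eq_iff raag_relators_def intro!: pres_rel.relation)

text \<open>Every element is the class of a word, and prepending letters to a word is left
  multiplication by a generator or its inverse.\<close>

lemma raag_induct [consumes 1, case_names one gen inv_gen]:
  assumes g: "g \<in> carrier (raag \<Gamma>)"
    and one: "P \<one>\<^bsub>raag \<Gamma>\<^esub>"
    and gen: "\<And>v g. v \<in> pverts \<Gamma> \<Longrightarrow> g \<in> carrier (raag \<Gamma>) \<Longrightarrow> P g \<Longrightarrow> P (gen \<Gamma> v \<otimes>\<^bsub>raag \<Gamma>\<^esub> g)"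
    and inv_gen: "\<And>v g. v \<in> pverts \<Gamma> \<Longrightarrow> g \<in> carrier (raag \<Gamma>) \<Longrightarrow> P g \<Longrightarrow>
      P (inv\<^bsub>raag \<Gamma>\<^esub> (gen \<Gamma> v) \<otimes>\<^bsub>raag \<Gamma>\<^esub> g)"
  shows "P g"
proof -
  obtain w where w: "w \<in> words (pverts \<Gamma>)" "g = raag_class \<Gamma> w" using g by (auto simp: raag_carrier)
  have "P (raag_class \<Gamma> w)" using w(1)
  proof (induction w)
    case Nil
    then show ?case using one by (simp add: raag_one)
  next
    case (Cons a w)
    obtain v b where a: "a = (v, b)" by force
    show ?case
      using Cons a gen[of v "raag_class \<Gamma> w"] inv_gen[of v "raag_class \<Gamma> w"]
      by (cases b) (auto simp: raag_inv raag_mult)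
  qed
  then show ?thesis using w by simp
qed

section \<open>Homomorphisms from a group to the additive reals\<close>

lemma hom_to_additive:
  fixes \<phi> :: "'a \<Rightarrow> real"
  assumes "group G" "\<phi> \<in> hom G real_group"
  shows hom_real_mult: "\<And>x y. x \<in> carrier G \<Longrightarrow> y \<in> carrier G \<Longrightarrow> \<phi> (x \<otimes>\<^bsub>G\<^esub> y) = \<phi> x + \<phi> y"
    and hom_real_one: "\<phi> \<one>\<^bsub>G\<^esub> = 0"
    and hom_real_inv: "\<And>x. x \<in> carrier G \<Longrightarrow> \<phi> (inv\<^bsub>G\<^esub> x) = - \<phi> x"
proof -
  interpret group G by fact
  show m: "\<And>x y. x \<in> carrier G \<Longrightarrow> y \<in> carrier G \<Longrightarrow> \<phi> (x \<otimes>\<^bsub>G\<^esub> y) = \<phi> x + \<phi> y"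
    using assms(2) by (auto simp: hom_def real_group_def)
  show o: "\<phi> \<one>\<^bsub>G\<^esub> = 0" using m[of "\<one>\<^bsub>G\<^esub>" "\<one>\<^bsub>G\<^esub>"] by simp
  show "\<phi> (inv\<^bsub>G\<^esub> x) = - \<phi> x" if "x \<in> carrier G" for x
    using m[of x "inv\<^bsub>G\<^esub> x"] o that by simp
qed

lemma hom_realI:
  "(\<And>x y. x \<in> carrier G \<Longrightarrow> y \<in> carrier G \<Longrightarrow> \<phi> (x \<otimes>\<^bsub>G\<^esub> y) = \<phi> x + \<phi> y) \<Longrightarrow> \<phi> \<in> hom G real_group"
  by (auto simp: hom_def real_group_def)

subsection \<open>Actions given on generators\<close>

text \<open>Words act from the left letter to the right one, so this is a right action.\<close>

definition word_act :: "('v \<Rightarrow> 'p \<Rightarrow> 'p) \<Rightarrow> 'v word \<Rightarrow> 'p \<Rightarrow> 'p" where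
  "word_act f w = fold (\<lambda>(v, b). if b then f v else Hilbert_Choice.inv (f v)) w"

text \<open>The chosen word does not matter once the permutations commute along arcs;
  \<open>raag_act_class\<close> then replaces it by any representative.\<close>

definition raag_act :: "('v \<Rightarrow> 'p \<Rightarrow> 'p) \<Rightarrow> 'v word set \<Rightarrow> 'p \<Rightarrow> 'p" where
  "raag_act f g = word_act f (SOME w. w \<in> g)"

definition commuting_perms :: "'v pair_pre_digraph \<Rightarrow> ('v \<Rightarrow> 'p \<Rightarrow> 'p) \<Rightarrow> bool" where
  "commuting_perms \<Gamma> f \<longleftrightarrow> (\<forall>v\<in>pverts \<Gamma>. bij (f v)) \<and> (\<forall>(v, w)\<in>parcs \<Gamma>. f v \<circ> f w = f w \<circ> f v)"

lemma word_act_simps [simp]: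
  "word_act f [] p = p"
  "word_act f ((v, b) # w) p = word_act f w ((if b then f v else Hilbert_Choice.inv (f v)) p)"
  "word_act f (u @ w) p = word_act f w (word_act f u p)"
  by (auto simp: word_act_def)

text \<open>Cancellation holds because each \<open>f x\<close> is a bijection, and the defining
  relations because maps joined by an arc commute.\<close>

lemma word_act_cong:
  assumes "commuting_perms \<Gamma> f" "(u, w) \<in> pres_rel (pverts \<Gamma>) (raag_relators \<Gamma>)"
  shows "word_act f u = word_act f w"
  using assms(2)
proof (induction rule: pres_rel.induct)
  case (cancel x b)
  then have "bij (f x)" using assms(1) by (auto simp: commuting_perms_def)
  then show ?case by (auto simp: fun_eq_iff bij_is_inj bij_is_surj surj_f_inv_f)
next
  case (relation u w)
  then obtain v x where "(v, x) \<in> parcs \<Gamma>" "u = [(v, True), (x, True)]" "w = [(x, True), (v, True)]"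
    by (auto simp: raag_relators_def)
  moreover from this have "f v \<circ> f x = f x \<circ> f v" using assms(1) by (auto simp: commuting_perms_def)
  ultimately show ?case by (auto simp: fun_eq_iff)
qed (auto simp: fun_eq_iff)

lemma raag_act_class:
  assumes "commuting_perms \<Gamma> f" "w \<in> words (pverts \<Gamma>)"
  shows "raag_act f (raag_class \<Gamma> w) = word_act f w"
proof -
  have "w \<in> raag_class \<Gamma> w" using assms(2) by (auto simp: raag_class_def intro: pres_rel.refl)
  then have "(SOME u. u \<in> raag_class \<Gamma> w) \<in> raag_class \<Gamma> w" by (rule someI)
  then show ?thesis using word_act_cong[OF assms(1)] by (auto simp: raag_act_def raag_class_def)
qed

lemma raag_act_mult:
  assumes "commuting_perms \<Gamma> f" "g \<in> carrier (raag \<Gamma>)" "h \<in> carrier (raag \<Gamma>)"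
  shows "raag_act f (g \<otimes>\<^bsub>raag \<Gamma>\<^esub> h) p = raag_act f h (raag_act f g p)"
  using assms by (auto simp: raag_carrier raag_mult raag_act_class)

lemma raag_act_gen:
  "commuting_perms \<Gamma> f \<Longrightarrow> v \<in> pverts \<Gamma> \<Longrightarrow> raag_act f (gen \<Gamma> v) p = f v p"
  by (simp add: raag_act_class)

lemma raag_act_one: "commuting_perms \<Gamma> f \<Longrightarrow> raag_act f \<one>\<^bsub>raag \<Gamma>\<^esub> p = p"
  by (simp add: raag_act_class raag_one)

lemma raag_act_inv_gen:
  "commuting_perms \<Gamma> f \<Longrightarrow> v \<in> pverts \<Gamma> \<Longrightarrow>
    raag_act f (inv\<^bsub>raag \<Gamma>\<^esub> (gen \<Gamma> v)) p = Hilbert_Choice.inv (f v) p"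
  by (simp add: raag_act_class raag_inv)

lemma raag_act_inv_act:
  assumes "commuting_perms \<Gamma> f" "g \<in> carrier (raag \<Gamma>)"
  shows "raag_act f (inv\<^bsub>raag \<Gamma>\<^esub> g) (raag_act f g p) = p"
  using raag_act_mult[OF assms(1,2), of "inv\<^bsub>raag \<Gamma>\<^esub> g" p] assms
    group.r_inv[OF group_raag assms(2)] group.inv_closed[OF group_raag assms(2)]
  by (simp add: raag_act_one)

subsection \<open>Real characters\<close>

lemma exponent_sum_simps [simp]:
  "exponent_sum x [] = 0"
  "exponent_sum x ((y, b) # w) = (if y = x then (if b then 1 else -1) else 0) + exponent_sum x w"
  "exponent_sum x (u @ w) = exponent_sum x u + exponent_sum x w"
  by (auto simp: exponent_sum_def)

lemma exponent_sum_cong: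
  "(u, w) \<in> pres_rel (pverts \<Gamma>) (raag_relators \<Gamma>) \<Longrightarrow> exponent_sum x u = exponent_sum x w"
  by (induction rule: pres_rel.induct) (auto simp: raag_relators_def)

lemma vertex_dual_class:
  assumes "w \<in> words (pverts \<Gamma>)"
  shows "vertex_dual x (raag_class \<Gamma> w) = exponent_sum x w"
proof -
  have "w \<in> raag_class \<Gamma> w" using assms by (auto simp: raag_class_def intro: pres_rel.refl)
  moreover have "exponent_sum x u = exponent_sum x w" if "u \<in> raag_class \<Gamma> w" for u
    using that exponent_sum_cong[of w u] by (simp add: raag_class_def)
  ultimately have "exponent_sum x ` raag_class \<Gamma> w = {exponent_sum x w}" by blast
  then show ?thesis by (simp add: vertex_dual_def)
qed

text \<open>The character with value \<open>c v\<close> at the generator \<open>v\<close>; by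
  \<open>hom_eq_lin\<close> every real character of the group arises this way.\<close>

definition lin :: "'v pair_pre_digraph \<Rightarrow> ('v \<Rightarrow> real) \<Rightarrow> 'v word set \<Rightarrow> real" where
  "lin \<Gamma> c g = (\<Sum>v\<in>pverts \<Gamma>. c v * vertex_dual v g)"

lemma lin_hom: "lin \<Gamma> c \<in> hom (raag \<Gamma>) real_group"
  by (rule hom_realI)
    (auto simp: lin_def raag_carrier raag_mult vertex_dual_class algebra_simps sum.distrib)

lemmas lin_mult = hom_real_mult[OF group_raag lin_hom]
  and lin_one = hom_real_one[OF group_raag lin_hom]
  and lin_inv = hom_real_inv[OF group_raag lin_hom]

lemma lin_gen:
  assumes "finite (pverts \<Gamma>)" "v \<in> pverts \<Gamma>"
  shows "lin \<Gamma> c (gen \<Gamma> v) = c v"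
proof -
  have "lin \<Gamma> c (gen \<Gamma> v) = (\<Sum>u\<in>pverts \<Gamma>. if u = v then c u else 0)"
    using assms by (simp add: lin_def vertex_dual_class if_distrib[of "(*) (c _)"] eq_commute[of v] cong: if_cong)
  then show ?thesis using assms by simp
qed

lemma hom_eq_lin:
  assumes fin: "finite (pverts \<Gamma>)" and \<phi>: "\<phi> \<in> hom (raag \<Gamma>) real_group" and g: "g \<in> carrier (raag \<Gamma>)"
    and c: "\<And>v. v \<in> pverts \<Gamma> \<Longrightarrow> \<phi> (gen \<Gamma> v) = c v"
  shows "\<phi> g = lin \<Gamma> c g"
  using g
proof (induction rule: raag_induct)
  case one
  then show ?case by (simp add: hom_real_one[OF group_raag \<phi>] lin_one)
next
  case (gen v g)
  then show ?case by (simp add: hom_real_mult[OF group_raag \<phi>] lin_mult lin_gen[OF fin] c)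
next
  case (inv_gen v g)
  then show ?case
    by (simp add: hom_real_mult[OF group_raag \<phi>] hom_real_inv[OF group_raag \<phi>] lin_mult lin_inv
        lin_gen[OF fin] c group.inv_closed[OF group_raag])
qed

lemma lin_lincomb: "lin \<Gamma> (\<lambda>v. s * c v + t * d v) g = s * lin \<Gamma> c g + t * lin \<Gamma> d g"
  by (simp add: lin_def sum.distrib sum_distrib_left algebra_simps)

lemma lin_cong: "(\<And>v. v \<in> pverts \<Gamma> \<Longrightarrow> c v = d v) \<Longrightarrow> lin \<Gamma> c g = lin \<Gamma> d g"
  by (simp add: lin_def)


section \<open>Disconnected subsets\<close>

text \<open>An arc-invariant property that tells two vertices apart refutes connectedness. It is
  applied both to the graph and to half-spaces of a Cayley graph.\<close>

lemma connected_induce_const: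
  assumes "Digraph_Component.connected (induce_subgraph (with_proj D) S)"
    and "\<And>u v. (u, v) \<in> parcs D \<Longrightarrow> u \<in> S \<Longrightarrow> v \<in> S \<Longrightarrow> Q u = Q v"
    and "x \<in> S" "y \<in> S"
  shows "Q x = Q y"
proof -
  let ?M = "mk_symmetric (induce_subgraph (with_proj D) S)"
  have arc: "Q u = Q v" if "(u, v) \<in> parcs ?M" for u v
    using that assms(2) by (fastforce simp: parcs_mk_symmetric)
  have "(x, y) \<in> rtrancl_on S (parcs ?M)"
    using assms(1,3,4) by (auto simp: Digraph_Component.connected_def strongly_connected_def reachable_def)
  then show ?thesis by (induction rule: rtrancl_on_induct) (auto dest: arc)
qed

text \<open>A certificate that \<open>W1 \<union> W2\<close> is disconnected. The empty set has no
  such splitting and is treated separately.\<close>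

definition separated :: "'v pair_pre_digraph \<Rightarrow> 'v set \<Rightarrow> 'v set \<Rightarrow> bool" where
  "separated \<Gamma> W1 W2 \<longleftrightarrow> W1 \<noteq> {} \<and> W2 \<noteq> {} \<and> W1 \<subseteq> pverts \<Gamma> \<and> W2 \<subseteq> pverts \<Gamma> \<and> W1 \<inter> W2 = {} \<and>
     (\<forall>(v, w)\<in>parcs \<Gamma>. \<not> (v \<in> W1 \<and> w \<in> W2) \<and> \<not> (v \<in> W2 \<and> w \<in> W1))"

lemma separated_sym: "separated \<Gamma> W1 W2 \<Longrightarrow> separated \<Gamma> W2 W1"
  by (auto simp: separated_def)

lemma separatedD:
  assumes "separated \<Gamma> W1 W2" "(v, w) \<in> parcs \<Gamma>"
  shows "v \<in> W1 \<Longrightarrow> w \<in> W2 \<Longrightarrow> False" "v \<in> W2 \<Longrightarrow> w \<in> W1 \<Longrightarrow> False"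
  using assms by (auto simp: separated_def)

lemma empty_disconnected: "{} \<in> disconnected_subsets \<Gamma>"
  by (auto simp: disconnected_subsets_def Digraph_Component.connected_def strongly_connected_def)

lemma separated_disconnected:
  assumes "separated \<Gamma> W1 W2"
  shows "W1 \<union> W2 \<in> disconnected_subsets \<Gamma>"
proof -
  have "\<not> Digraph_Component.connected (induce_subgraph (with_proj \<Gamma>) (W1 \<union> W2))"
  proof
    assume c: "Digraph_Component.connected (induce_subgraph (with_proj \<Gamma>) (W1 \<union> W2))"
    obtain x y where xy: "x \<in> W1" "y \<in> W2" using assms by (auto simp: separated_def)
    have "(x \<in> W1) = (y \<in> W1)"
      by (rule connected_induce_const[OF c]) (use xy separatedD[OF assms] in auto)
    then show False using xy assms by (auto simp: separated_def)
  qed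
  then show ?thesis using assms by (auto simp: disconnected_subsets_def separated_def)
qed

lemma disconnected_separated:
  assumes "W \<in> disconnected_subsets \<Gamma>" "W \<noteq> {}"
  obtains W1 W2 where "separated \<Gamma> W1 W2" "W = W1 \<union> W2"
proof -
  let ?M = "mk_symmetric (induce_subgraph (with_proj \<Gamma>) W)"
  obtain x y where xy: "x \<in> W" "y \<in> W" "(x, y) \<notin> rtrancl_on W (parcs ?M)"
    using assms
    by (auto simp: disconnected_subsets_def Digraph_Component.connected_def strongly_connected_def reachable_def)
  \<comment> \<open>The component of \<open>x\<close>; it misses \<open>y\<close>, so its complement
    in \<open>W\<close> is nonempty.\<close>
  define W1 where "W1 = {z \<in> W. (x, z) \<in> rtrancl_on W (parcs ?M)}"
  have step: "w \<in> W1" if "v \<in> W1" "w \<in> W" "(v, w) \<in> parcs \<Gamma> \<or> (w, v) \<in> parcs \<Gamma>" for v w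
  proof -
    have "(v, w) \<in> parcs ?M" using that by (auto simp: W1_def parcs_mk_symmetric)
    then show ?thesis using that by (auto simp: W1_def intro: rtrancl_on_into_rtrancl_on)
  qed
  have "separated \<Gamma> W1 (W - W1)"
    using xy assms step by (auto simp: separated_def W1_def disconnected_subsets_def)
  moreover have "W = W1 \<union> (W - W1)" by (auto simp: W1_def)
  ultimately show ?thesis using that by blast
qed

section \<open>The kernel of an epimorphism onto the integers\<close>

locale raag_epi =
  fixes \<Gamma> :: "'v pair_pre_digraph" and \<chi> :: "'v word set \<Rightarrow> int"
  assumes graph: "pair_graph \<Gamma>" and epi: "\<chi> \<in> epi (raag \<Gamma>) integer_group"
begin

abbreviation G where "G \<equiv> raag \<Gamma>"
abbreviation N where "N \<equiv> kernel_group (raag \<Gamma>) \<chi>"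
abbreviation V where "V \<equiv> pverts \<Gamma>"

sublocale G: group G by (rule group_raag)

lemma finite_V: "finite V"
  using graph by (simp add: pair_graph_def pair_digraph_def pair_fin_digraph.pair_finite_verts)

lemma arcs_V: "(v, w) \<in> parcs \<Gamma> \<Longrightarrow> v \<in> V \<and> w \<in> V"
  using graph
  by (auto simp: pair_graph_def pair_digraph_def pair_fin_digraph_def dest: pair_wf_digraph.wellformed')

lemma chi_mult: "g \<in> carrier G \<Longrightarrow> h \<in> carrier G \<Longrightarrow> \<chi> (g \<otimes>\<^bsub>G\<^esub> h) = \<chi> g + \<chi> h"
  using epi by (auto simp: epi_def hom_def)

lemma chi_one: "\<chi> \<one>\<^bsub>G\<^esub> = 0" using chi_mult[of "\<one>\<^bsub>G\<^esub>" "\<one>\<^bsub>G\<^esub>"] by simp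

lemma chi_inv: "g \<in> carrier G \<Longrightarrow> \<chi> (inv\<^bsub>G\<^esub> g) = - \<chi> g"
  using chi_mult[of g "inv\<^bsub>G\<^esub> g"] chi_one by simp

lemma chi_onto: "\<exists>t\<in>carrier G. \<chi> t = 1"
  using epi by (auto simp: epi_def image_iff intro: sym) (metis UNIV_I imageE)

lemma carrier_N: "carrier N = {g \<in> carrier G. \<chi> g = 0}"
  by (simp add: kernel_group_def kernel_def)

lemma mult_N [simp]: "x \<otimes>\<^bsub>N\<^esub> y = x \<otimes>\<^bsub>G\<^esub> y" and one_N [simp]: "\<one>\<^bsub>N\<^esub> = \<one>\<^bsub>G\<^esub>"
  by (simp_all add: kernel_group_def)

lemma kernel_eq: "kernel G integer_group \<chi> = carrier N"
  by (simp add: kernel_group_def)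

lemma N_eq: "G\<lparr>carrier := carrier N\<rparr> = N"
  by (simp add: kernel_group_def)

lemma subgroup_N: "subgroup (carrier N) G"
  by (rule G.subgroupI) (auto simp: carrier_N chi_mult chi_inv chi_one)

lemma group_N: "group N"
  using G.subgroup_imp_group[OF subgroup_N] by (simp add: N_eq)

sublocale N: group N by (rule group_N)

lemma N_in_G: "x \<in> carrier N \<Longrightarrow> x \<in> carrier G" by (simp add: carrier_N)

lemma conj_in_N:
  "g \<in> carrier G \<Longrightarrow> x \<in> carrier N \<Longrightarrow> g \<otimes>\<^bsub>G\<^esub> x \<otimes>\<^bsub>G\<^esub> inv\<^bsub>G\<^esub> g \<in> carrier N"
  by (auto simp: carrier_N chi_mult chi_inv)

text \<open>The coordinates of \<chi> as a real character, so that \<open>lin \<Gamma> ht\<close> is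
  \<chi>.\<close>

definition ht :: "'v \<Rightarrow> real" where "ht v = of_int (\<chi> (gen \<Gamma> v))"

lemma chi_eq_lin: "g \<in> carrier G \<Longrightarrow> real_of_int (\<chi> g) = lin \<Gamma> ht g"
  by (rule hom_eq_lin[OF finite_V]) (auto intro!: hom_realI simp: chi_mult ht_def)

subsection \<open>Half-spaces\<close>

text \<open>A point \<open>(s, r)\<close> lies on sheet \<open>s\<close> over the real number
  \<open>r\<close>. Letters swap the sheets only near 0, so a fixed element, being a finite word,
  swaps nothing when started far enough to the right.\<close>

lemma sheet_action:
  assumes f: "commuting_perms \<Gamma> f"
    and f_def: "\<And>v s r. f v (s, r) = (s \<noteq> flip v r, r + c v)"
    and flip: "\<And>v r. flip v r \<Longrightarrow> \<bar>r\<bar> \<le> \<bar>c v\<bar>"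
  shows "g \<in> carrier G \<Longrightarrow> snd (raag_act f g (s, r)) = r + lin \<Gamma> c g"
    and "g \<in> carrier G \<Longrightarrow> \<exists>B. \<forall>r>B. \<forall>s. raag_act f g (s, r) = (s, r + lin \<Gamma> c g)"
proof -
  have inv: "Hilbert_Choice.inv (f v) (s, r) = (s \<noteq> flip v (r - c v), r - c v)" if "v \<in> V" for v s r
    using f that by (intro inv_f_eq) (auto simp: commuting_perms_def f_def bij_is_inj)
  show "snd (raag_act f g (s, r)) = r + lin \<Gamma> c g" if "g \<in> carrier G" for s r
    using that
    by (induction arbitrary: s r rule: raag_induct)
      (auto simp: raag_act_one[OF f] raag_act_mult[OF f] raag_act_gen[OF f] raag_act_inv_gen[OF f]
        f_def inv lin_one lin_mult lin_inv lin_gen finite_V)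
  show "\<exists>B. \<forall>r>B. \<forall>s. raag_act f g (s, r) = (s, r + lin \<Gamma> c g)" if "g \<in> carrier G"
    using that
  proof (induction rule: raag_induct)
    case one
    then show ?case by (auto simp: raag_act_one[OF f] lin_one)
  next
    case (gen v g)
    then obtain B where B: "\<And>r s. r > B \<Longrightarrow> raag_act f g (s, r) = (s, r + lin \<Gamma> c g)" by blast
    have "raag_act f (gen \<Gamma> v \<otimes>\<^bsub>G\<^esub> g) (s, r) = (s, r + lin \<Gamma> c (gen \<Gamma> v \<otimes>\<^bsub>G\<^esub> g))"
      \<comment> \<open>Large enough that \<open>v\<close> does not flip at \<open>r\<close> and
        that \<open>r + c v\<close> still exceeds \<open>B\<close>.\<close>
      if "r > \<bar>B\<bar> + \<bar>c v\<bar>" for r s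
      using flip[of v r] that B[of "r + c v"] gen(1,2)
      by (auto simp: raag_act_mult[OF f] raag_act_gen[OF f] f_def lin_mult lin_gen finite_V)
    then show ?case by blast
  next
    case (inv_gen v g)
    then obtain B where B: "\<And>r s. r > B \<Longrightarrow> raag_act f g (s, r) = (s, r + lin \<Gamma> c g)" by blast
    have "raag_act f (inv\<^bsub>G\<^esub> (gen \<Gamma> v) \<otimes>\<^bsub>G\<^esub> g) (s, r) = (s, r + lin \<Gamma> c (inv\<^bsub>G\<^esub> (gen \<Gamma> v) \<otimes>\<^bsub>G\<^esub> g))"
      \<comment> \<open>The inverse letter flips according to the position \<open>r - c v\<close>,
        which must itself exceed \<open>\<bar>c v\<bar>\<close> and \<open>B\<close>; hence the
        factor 2.\<close>
      if "r > \<bar>B\<bar> + 2 * \<bar>c v\<bar>" for r s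
      using flip[of v "r - c v"] that B[of "r - c v"] inv_gen(1,2)
      by (auto simp: raag_act_mult[OF f] raag_act_inv_gen[OF f] inv lin_mult lin_inv lin_gen finite_V)
    then show ?case by blast
  qed
qed

text \<open>The sheet reached from a distant base point is constant along paths in the half-space,
  yet it differs at the identity and at a suitable commutator, both of which lie in the
  half-space.\<close>

lemma half_space_disconnected:
  assumes sep: "separated \<Gamma> W1 W2"
    and supp: "\<And>v. v \<in> V \<Longrightarrow> v \<notin> W1 \<Longrightarrow> v \<notin> W2 \<Longrightarrow> c v = 0"
    and a: "a \<in> W1" "c a \<noteq> 0"
    and S: "finite S" "S \<subseteq> carrier N"
  shows "\<not> Digraph_Component.connected
      (induce_subgraph (with_proj (cayley_graph N S)) {g \<in> carrier N. lin \<Gamma> c g \<ge> 0})"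
proof
  assume conn: "Digraph_Component.connected
      (induce_subgraph (with_proj (cayley_graph N S)) {g \<in> carrier N. lin \<Gamma> c g \<ge> 0})"
  \<comment> \<open>Choosing \<open>b\<close> with nonzero coefficient whenever possible guarantees
    that \<open>b\<close> flips at position 0.\<close>
  obtain b where b: "b \<in> W2" "(\<exists>u\<in>W2. c u \<noteq> 0) \<Longrightarrow> c b \<noteq> 0"
    using sep unfolding separated_def by (metis all_not_in_conv)
  \<comment> \<open>If \<open>c\<close> is nonzero somewhere on \<open>W2\<close>, the letters of
    \<open>W2\<close> act by translations conjugated with the swap of the two sheets over 0, hence
    commute with each other. If \<open>c\<close> vanishes on \<open>W2\<close>, the letter
    \<open>b\<close> alone swaps the sheets over 0.\<close>
  define flip where "flip v r \<longleftrightarrow> v \<in> W2 \<and>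
     (if \<exists>u\<in>W2. c u \<noteq> 0 then (r = 0) \<noteq> (r + c v = 0) else v = b \<and> r = 0)" for v and r :: real
  define f where "f v = (\<lambda>(s, r). (s \<noteq> flip v r, r + c v))" for v
  have f_def': "f v (s, r) = (s \<noteq> flip v r, r + c v)" for v s r by (simp add: f_def)
  have flip_bd: "\<bar>r\<bar> \<le> \<bar>c v\<bar>" if "flip v r" for v r using that by (auto simp: flip_def split: if_splits)
  have aV: "a \<in> V" and bV: "b \<in> V" and aW2: "a \<notin> W2" using sep a b by (auto simp: separated_def)
  have f: "commuting_perms \<Gamma> f" unfolding commuting_perms_def
  proof (intro conjI ballI, goal_cases)
    case (1 v)
    show ?case
      by (rule o_bij[where g = "\<lambda>(s, r). (s \<noteq> flip v (r - c v), r - c v)"]) (auto simp: fun_eq_iff f_def)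
  next
    case (2 e)
    obtain v w where e: "e = (v, w)" by force
    note vw = 2[unfolded e]
    have "(flip v r \<noteq> flip w (r + c v)) = (flip w r \<noteq> flip v (r + c w))" for r
    proof -
      \<comment> \<open>A neighbour of a vertex of \<open>W2\<close> that is not in
        \<open>W2\<close> is not in \<open>W1\<close> either, so its coefficient is 0 and it acts
        trivially.\<close>
      have "v \<in> W2 \<and> w \<in> W2 \<or> v \<in> W2 \<and> w \<notin> W2 \<and> c w = 0 \<or> v \<notin> W2 \<and> w \<in> W2 \<and> c v = 0 \<or> v \<notin> W2 \<and> w \<notin> W2"
        using separatedD[OF sep vw] arcs_V[OF vw] supp[of v] supp[of w] by blast
      then consider "v \<in> W2" "w \<in> W2" | "v \<in> W2" "w \<notin> W2" "c w = 0" | "v \<notin> W2" "w \<in> W2" "c v = 0"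
        | "v \<notin> W2" "w \<notin> W2" by blast
      then show ?thesis
      proof cases
        case 1
        show ?thesis
        proof (cases "\<exists>u\<in>W2. c u \<noteq> 0")
          case True
          then have "flip v r = ((r = 0) \<noteq> (r + c v = 0))" "flip w r = ((r = 0) \<noteq> (r + c w = 0))"
            for r using 1 unfolding flip_def by simp_all
          then show ?thesis by (simp only: add_ac) argo
        next
          case False
          then show ?thesis using 1 by (auto simp: flip_def)
        qed
      qed (simp_all add: flip_def)
    qed
    then show ?case by (auto simp: e fun_eq_iff f_def)
  qed
  have act1: "snd (raag_act f g (s, r)) = r + lin \<Gamma> c g" if "g \<in> carrier G" for g s r
    using sheet_action(1)[OF f f_def' _ that] flip_bd by blast
  have act2: "\<exists>B. \<forall>r>B. \<forall>s. raag_act f g (s, r) = (s, r + lin \<Gamma> c g)" if "g \<in> carrier G" for g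
    using sheet_action(2)[OF f f_def' _ that] flip_bd by blast
  \<comment> \<open>The sign is chosen so that \<open>\<alpha>\<close> always translates to the
    left, by \<open>d\<close>.\<close>
  define \<alpha> where "\<alpha> = (if c a < 0 then gen \<Gamma> a else inv\<^bsub>G\<^esub> (gen \<Gamma> a))"
  define d where "d = \<bar>c a\<bar>"
  have d: "d > 0" using a by (simp add: d_def)
  have ga: "gen \<Gamma> a \<in> carrier G" "gen \<Gamma> b \<in> carrier G" using aV bV by auto
  then have \<alpha>: "\<alpha> \<in> carrier G" by (auto simp: \<alpha>_def)
  have act_a: "f a (s, r) = (s, r + c a)" for s r using aW2 by (auto simp: f_def flip_def)
  have act_\<alpha>: "raag_act f \<alpha> (s, r) = (s, r - d)" for s r
    using raag_act_inv_act[OF f ga(1), of "(s, r - c a)"]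
    by (auto simp: \<alpha>_def d_def raag_act_gen[OF f aV] act_a)
  have act_pow: "raag_act f (\<alpha> [^]\<^bsub>G\<^esub> n) (s, r) = (s, r - real n * d)" for n :: nat and s r
    by (induction n) (auto simp: raag_act_one[OF f] raag_act_mult[OF f] \<alpha> act_\<alpha> algebra_simps)
  have act_pow_inv: "raag_act f (inv\<^bsub>G\<^esub> (\<alpha> [^]\<^bsub>G\<^esub> n)) (s, r) = (s, r + real n * d)" for n :: nat and s r
    using raag_act_inv_act[OF f, of "\<alpha> [^]\<^bsub>G\<^esub> n" "(s, r + real n * d)"] \<alpha> by (simp add: act_pow)
  obtain B where B: "\<And>g r s. g \<in> S \<Longrightarrow> r > B g \<Longrightarrow> raag_act f g (s, r) = (s, r + lin \<Gamma> c g)"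
    using act2 S(2) N_in_G by (metis subsetD)
  obtain n :: nat where n: "real n * d > Max (insert \<bar>c b\<bar> (B ` S))"
    using reals_Archimedean3[OF d] by blast
  \<comment> \<open>An exact multiple of \<open>d\<close>, so that \<open>\<alpha> [^] n\<close>
    carries \<open>K\<close> precisely onto 0; it also exceeds the flip range of \<open>b\<close>
    and the bounds of all generators in \<open>S\<close>.\<close>
  define K where "K = real n * d"
  have K: "K > \<bar>c b\<bar>" "\<And>g. g \<in> S \<Longrightarrow> K > B g"
    using n S(1) by (auto simp: K_def)
  define Q where "Q g = fst (raag_act f g (False, K))" for g
  let ?H = "{g \<in> carrier N. lin \<Gamma> c g \<ge> 0}"
  \<comment> \<open>In the right action: move from \<open>K\<close> to 0, swap sheets by
    \<open>b\<close>, move back, and undo \<open>b\<close> far from 0, where it does not swap. A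
    commutator lies in \<open>N\<close> and has value 0 under every character.\<close>
  define h where "h = \<alpha> [^]\<^bsub>G\<^esub> n \<otimes>\<^bsub>G\<^esub> gen \<Gamma> b \<otimes>\<^bsub>G\<^esub> inv\<^bsub>G\<^esub> (\<alpha> [^]\<^bsub>G\<^esub> n) \<otimes>\<^bsub>G\<^esub> inv\<^bsub>G\<^esub> (gen \<Gamma> b)"
  have hN: "h \<in> carrier N" using \<alpha> ga by (simp add: h_def carrier_N chi_mult chi_inv)
  have hc: "lin \<Gamma> c h = 0" using \<alpha> ga by (simp add: h_def lin_mult lin_inv)
  have "Q \<one>\<^bsub>G\<^esub> = Q h"
  proof (rule connected_induce_const[OF conn])
    fix u v assume "(u, v) \<in> parcs (cayley_graph N S)" and u: "u \<in> ?H" and "v \<in> ?H"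
    then obtain s where s: "s \<in> S" "v = u \<otimes>\<^bsub>G\<^esub> s" by (auto simp: cayley_graph_def)
    have uG: "u \<in> carrier G" and sG: "s \<in> carrier G" using u s S N_in_G by auto
    have "snd (raag_act f u (False, K)) > B s" using act1[OF uG] u K(2)[OF s(1)] by auto
    then have "raag_act f s (raag_act f u (False, K)) =
        (Q u, snd (raag_act f u (False, K)) + lin \<Gamma> c s)"
      using B[OF s(1), of "snd (raag_act f u (False, K))" "fst (raag_act f u (False, K))"] by (simp add: Q_def)
    then show "Q u = Q v" by (simp add: s Q_def raag_act_mult[OF f uG sG])
  qed (use hN hc N.one_closed in \<open>auto simp: lin_one\<close>)
  moreover have "\<not> Q \<one>\<^bsub>G\<^esub>" by (simp add: Q_def raag_act_one[OF f])
  moreover have "Q h"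
  proof -
    have "f b (False, 0) = (True, c b)" using b by (auto simp: f_def flip_def)
    moreover have "raag_act f (inv\<^bsub>G\<^esub> (gen \<Gamma> b)) (True, c b + K) = (True, K)"
    proof -
      have "\<not> flip b K" using K(1) flip_bd[of b K] by auto
      then show ?thesis
        using raag_act_inv_act[OF f ga(2), of "(True, K)"]
        by (simp add: raag_act_gen[OF f bV] f_def add_ac)
    qed
    ultimately show ?thesis
      using \<alpha> ga bV
      by (simp add: Q_def h_def raag_act_mult[OF f] act_pow act_pow_inv raag_act_gen[OF f] flip: K_def)
  qed
  ultimately show False by simp
qed

end


section \<open>Cohomology in low degrees\<close>

text \<open>Vanishing of \<open>b \<union> a\<close> in the second cohomology: \<eta> is a 1-cochain
  whose bar coboundary is the cup product.\<close>

definition cup_trivial :: "('a, 'm) monoid_scheme \<Rightarrow> ('a \<Rightarrow> real) \<Rightarrow> ('a \<Rightarrow> real) \<Rightarrow> bool" where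
  "cup_trivial H b a \<longleftrightarrow>
    (\<exists>\<eta>. \<forall>x\<in>carrier H. \<forall>y\<in>carrier H. \<eta> (x \<otimes>\<^bsub>H\<^esub> y) = \<eta> x + \<eta> y - b x * a y)"

definition hom_cochain :: "('a, 'm) monoid_scheme \<Rightarrow> ('a \<Rightarrow> real) \<Rightarrow> 'a list \<Rightarrow> real" where
  "hom_cochain H \<phi> = (\<lambda>xs. if xs \<in> tuples H 1 then \<phi> (hd xs) else 0)"

section \<open>The bar complex in low degrees\<close>

lemma tuples_0: "xs \<in> tuples H 0 \<longleftrightarrow> xs = []"
  and tuples_1: "xs \<in> tuples H (Suc 0) \<longleftrightarrow> (\<exists>x\<in>carrier H. xs = [x])"
  and tuples_2: "xs \<in> tuples H (Suc (Suc 0)) \<longleftrightarrow> (\<exists>x\<in>carrier H. \<exists>y\<in>carrier H. xs = [x, y])"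
  and tuples_3: "xs \<in> tuples H (Suc (Suc (Suc 0))) \<longleftrightarrow>
    (\<exists>x\<in>carrier H. \<exists>y\<in>carrier H. \<exists>z\<in>carrier H. xs = [x, y, z])"
  by (auto simp: tuples_def length_Suc_conv)

text \<open>Both faces of \<open>[x]\<close> are the empty list and cancel. Hence there are no
  nonzero coboundaries in degree 1, and classes there are singletons.\<close>

lemma bar_coboundary_0: "bar_coboundary H 0 f = (\<lambda>xs. 0)"
  by (auto simp: bar_coboundary_def tuples_1 bar_face_def fun_eq_iff)

lemma bar_coboundary_1:
  "x \<in> carrier H \<Longrightarrow> y \<in> carrier H \<Longrightarrow>
    bar_coboundary H (Suc 0) f [x, y] = f [y] - f [x \<otimes>\<^bsub>H\<^esub> y] + f [x]"
  by (auto simp: bar_coboundary_def tuples_2 bar_face_def)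

lemma bar_coboundary_2:
  "x \<in> carrier H \<Longrightarrow> y \<in> carrier H \<Longrightarrow> z \<in> carrier H \<Longrightarrow>
    bar_coboundary H (Suc (Suc 0)) f [x, y, z] =
      f [y, z] - f [x \<otimes>\<^bsub>H\<^esub> y, z] + f [x, y \<otimes>\<^bsub>H\<^esub> z] - f [x, y]"
  by (auto simp: bar_coboundary_def tuples_3 bar_face_def)

lemma bar_coboundary_off: "xs \<notin> tuples H (Suc n) \<Longrightarrow> bar_coboundary H n f xs = 0"
  by (simp add: bar_coboundary_def)

lemma bar_coboundaries_1: "bar_coboundaries H (Suc 0) = {\<lambda>xs. 0}"
proof -
  have "(\<lambda>xs. 0) \<in> carrier (bar_cochains H 0)" by (simp add: bar_cochains_def)
  then show ?thesis by (auto simp: bar_coboundaries_def bar_coboundary_0)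
qed

lemma coh_class_1: "coh_class H (Suc 0) f = {f}"
  by (simp add: coh_class_def r_coset_def bar_coboundaries_1 bar_cochains_def)

lemma hom_class_eq: "hom_class H \<phi> = {hom_cochain H \<phi>}"
  by (simp add: hom_class_def coh_class_1 hom_cochain_def)

lemma hom_cochain_eq_iff: "hom_cochain H \<phi> = hom_cochain H \<psi> \<longleftrightarrow> (\<forall>x\<in>carrier H. \<phi> x = \<psi> x)"
  by (auto simp: hom_cochain_def fun_eq_iff tuples_1)

lemma bar_cocycles_1: "bar_cocycles H (Suc 0) = hom_cochain H ` hom H real_group" if "group H"
proof -
  interpret group H by fact
  have "hom_cochain H \<phi> \<in> bar_cocycles H (Suc 0)" if "\<phi> \<in> hom H real_group" for \<phi>
  proof -
    have "bar_coboundary H (Suc 0) (hom_cochain H \<phi>) xs = 0" for xs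
    proof (cases "xs \<in> tuples H (Suc (Suc 0))")
      case True
      then show ?thesis
        using hom_real_mult[OF \<open>group H\<close> that]
        by (auto simp: tuples_2 bar_coboundary_1 hom_cochain_def tuples_1)
    qed (simp add: bar_coboundary_off)
    then show ?thesis by (auto simp: bar_cocycles_def bar_cochains_def hom_cochain_def)
  qed
  moreover have "f \<in> hom_cochain H ` hom H real_group" if f: "f \<in> bar_cocycles H (Suc 0)" for f
  proof
    have off: "\<And>xs. xs \<notin> tuples H (Suc 0) \<Longrightarrow> f xs = 0"
      and 0: "\<And>xs. bar_coboundary H (Suc 0) f xs = 0"
      using f by (auto simp: bar_cocycles_def bar_cochains_def fun_eq_iff)
    show "f = hom_cochain H (\<lambda>x. f [x])"
      using off by (fastforce simp: hom_cochain_def fun_eq_iff tuples_1)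
    show "(\<lambda>x. f [x]) \<in> hom H real_group"
    proof (rule hom_realI)
      fix x y assume "x \<in> carrier H" "y \<in> carrier H"
      then show "f [x \<otimes>\<^bsub>H\<^esub> y] = f [x] + f [y]" using bar_coboundary_1[of x H y f] 0[of "[x, y]"] by simp
    qed
  qed
  ultimately show ?thesis by blast
qed

lemma carrier_cohomology_1:
  "group H \<Longrightarrow> carrier (group_cohomology H 1) = hom_class H ` hom H real_group"
  by (auto simp: group_cohomology_def FactGroup_def RCOSETS_def r_coset_def bar_coboundaries_1
      bar_cocycles_1 hom_class_eq bar_cochains_def)

lemma cohomology_map_hom_class:
  assumes "carrier H \<subseteq> carrier K"
  shows "cohomology_map H 1 (\<lambda>x. x) (hom_class K \<phi>) = hom_class H \<phi>"
  using assms
  by (auto simp: cohomology_map_def hom_class_eq coh_class_1 hom_cochain_def fun_eq_iff tuples_1)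

lemma bar_coboundaries_2:
  "u \<in> bar_coboundaries H (Suc (Suc 0)) \<longleftrightarrow> (\<forall>xs. xs \<notin> tuples H (Suc (Suc 0)) \<longrightarrow> u xs = 0) \<and>
    (\<exists>\<eta>. \<forall>x\<in>carrier H. \<forall>y\<in>carrier H. u [x, y] = \<eta> y - \<eta> (x \<otimes>\<^bsub>H\<^esub> y) + \<eta> x)" (is "_ \<longleftrightarrow> ?R")
  if "group H"
proof
  interpret group H by fact
  assume "u \<in> bar_coboundaries H (Suc (Suc 0))"
  then obtain f where "u = bar_coboundary H (Suc 0) f" by (auto simp: bar_coboundaries_def)
  then show ?R by (auto simp: bar_coboundary_off bar_coboundary_1 intro!: exI[of _ "\<lambda>x. f [x]"])
next
  interpret group H by fact
  assume ?R
  then obtain \<eta> where off: "\<And>xs. xs \<notin> tuples H (Suc (Suc 0)) \<Longrightarrow> u xs = 0"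
    and \<eta>: "\<And>x y. x \<in> carrier H \<Longrightarrow> y \<in> carrier H \<Longrightarrow> u [x, y] = \<eta> y - \<eta> (x \<otimes>\<^bsub>H\<^esub> y) + \<eta> x" by blast
  have "u xs = bar_coboundary H (Suc 0) (hom_cochain H \<eta>) xs" for xs
  proof (cases "xs \<in> tuples H (Suc (Suc 0))")
    case True
    then show ?thesis using \<eta> by (auto simp: tuples_2 bar_coboundary_1 hom_cochain_def tuples_1)
  qed (simp add: bar_coboundary_off off)
  moreover have "hom_cochain H \<eta> \<in> carrier (bar_cochains H (Suc 0))"
    by (simp add: bar_cochains_def hom_cochain_def)
  ultimately show "u \<in> bar_coboundaries H (Suc (Suc 0))"
    by (auto simp: bar_coboundaries_def fun_eq_iff intro!: image_eqI[of _ _ "hom_cochain H \<eta>"])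
qed

text \<open>Coboundaries are closed under \<open>f + k * h\<close>; the cases \<open>k = 1\<close>
  and \<open>k = -1\<close> give the two inclusions between the coset and the subgroup.\<close>

lemma coh_class_2_eq_one:
  assumes "group H"
  shows "coh_class H (Suc (Suc 0)) u = bar_coboundaries H (Suc (Suc 0)) \<longleftrightarrow>
    u \<in> bar_coboundaries H (Suc (Suc 0))"
proof -
  let ?B = "bar_coboundaries H (Suc (Suc 0))"
  have cl: "coh_class H (Suc (Suc 0)) u = {\<lambda>xs. h xs + u xs |h. h \<in> ?B}"
    by (auto simp: coh_class_def r_coset_def bar_cochains_def)
  have comb: "(\<lambda>xs. f xs + k * h xs) \<in> ?B" if fB: "f \<in> ?B" and hB: "h \<in> ?B" for f h and k :: real
  proof -
    obtain \<eta> where \<eta>: "\<forall>x\<in>carrier H. \<forall>y\<in>carrier H. f [x, y] = \<eta> y - \<eta> (x \<otimes>\<^bsub>H\<^esub> y) + \<eta> x"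
      using fB unfolding bar_coboundaries_2[OF assms] by blast
    obtain \<theta> where \<theta>: "\<forall>x\<in>carrier H. \<forall>y\<in>carrier H. h [x, y] = \<theta> y - \<theta> (x \<otimes>\<^bsub>H\<^esub> y) + \<theta> x"
      using hB unfolding bar_coboundaries_2[OF assms] by blast
    show ?thesis
      unfolding bar_coboundaries_2[OF assms]
    proof (intro conjI exI[of _ "\<lambda>x. \<eta> x + k * \<theta> x"] ballI)
      show "\<forall>xs. xs \<notin> tuples H (Suc (Suc 0)) \<longrightarrow> f xs + k * h xs = 0"
        using fB hB by (simp add: bar_coboundaries_2[OF assms])
    qed (simp add: \<eta> \<theta> algebra_simps)
  qed
  have zero: "(\<lambda>xs. 0) \<in> ?B" by (auto simp: bar_coboundaries_2[OF assms] intro!: exI[of _ "\<lambda>_. 0"])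
  show ?thesis
  proof
    assume "coh_class H (Suc (Suc 0)) u = ?B"
    moreover have "u \<in> coh_class H (Suc (Suc 0)) u" using zero by (force simp: cl)
    ultimately show "u \<in> ?B" by simp
  next
    assume u: "u \<in> ?B"
    have "h \<in> coh_class H (Suc (Suc 0)) u" if "h \<in> ?B" for h
      using comb[OF that u, of "-1"] by (auto simp: cl intro!: exI[of _ "\<lambda>xs. h xs - u xs"])
    moreover have "coh_class H (Suc (Suc 0)) u \<subseteq> ?B" using comb[OF _ u, of _ 1] by (auto simp: cl)
    ultimately show "coh_class H (Suc (Suc 0)) u = ?B" by blast
  qed
qed

section \<open>Resonance expressed by cup products of characters\<close>

lemma cup_hom_class_eq_one:
  assumes "group H"
  shows "cup H 1 1 (hom_class H b) (hom_class H a) = \<one>\<^bsub>group_cohomology H (1 + 1)\<^esub> \<longleftrightarrow> cup_trivial H b a"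
proof -
  let ?u = "cup_cochain H 1 1 (hom_cochain H b) (hom_cochain H a)"
  have "cup H 1 1 (hom_class H b) (hom_class H a) = coh_class H (Suc (Suc 0)) ?u"
    by (simp add: cup_def hom_class_eq)
  moreover have "\<one>\<^bsub>group_cohomology H (1 + 1)\<^esub> = bar_coboundaries H (Suc (Suc 0))"
    by (simp add: group_cohomology_def FactGroup_def)
  moreover have "?u \<in> bar_coboundaries H (Suc (Suc 0)) \<longleftrightarrow> cup_trivial H b a"
  proof -
    have u: "?u [x, y] = b x * a y" if "x \<in> carrier H" "y \<in> carrier H" for x y
      using that by (auto simp: cup_cochain_def tuples_2 hom_cochain_def tuples_1)
    have "(?u [x, y] = \<eta> y - \<eta> (x \<otimes>\<^bsub>H\<^esub> y) + \<eta> x) = (\<eta> (x \<otimes>\<^bsub>H\<^esub> y) = \<eta> x + \<eta> y - b x * a y)"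
      if "x \<in> carrier H" "y \<in> carrier H" for x y \<eta> using u[OF that] by auto
    moreover have "?u xs = 0" if "xs \<notin> tuples H (Suc (Suc 0))" for xs
      using that by (simp add: cup_cochain_def)
    ultimately show ?thesis by (simp add: bar_coboundaries_2[OF assms] cup_trivial_def)
  qed
  ultimately show ?thesis using coh_class_2_eq_one[OF assms] by simp
qed

text \<open>Degree-zero cocycles are constants, so the image of multiplication by \<open>a\<close>
  is the line through \<open>a\<close>.\<close>

lemma cup_0_image:
  "(\<lambda>c. cup H 0 1 c (hom_class H a)) ` carrier (group_cohomology H 0) =
    range (\<lambda>k. hom_class H (\<lambda>x. k * a x))"
proof -
  define e where "e k = (\<lambda>xs :: 'a list. if xs = [] then k else (0::real))" for k
  have coc: "bar_cocycles H 0 = range e"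
    by (auto simp: bar_cocycles_def bar_cochains_def bar_coboundary_0 e_def tuples_0 fun_eq_iff image_iff)
  have "carrier (group_cohomology H 0) = (\<lambda>k. {e k}) ` UNIV"
    by (auto simp: group_cohomology_def FactGroup_def RCOSETS_def r_coset_def bar_coboundaries_def
        coc bar_cochains_def)
  moreover have "cup H 0 1 {e k} (hom_class H a) = hom_class H (\<lambda>x. k * a x)" for k
    by (auto simp: cup_def hom_class_eq coh_class_1 cup_cochain_def hom_cochain_def e_def fun_eq_iff)
  ultimately show ?thesis by (auto simp: image_image)
qed

lemma hom_class_mult:
  "hom_class H \<phi> \<otimes>\<^bsub>group_cohomology H 1\<^esub> hom_class H \<psi> = hom_class H (\<lambda>x. \<phi> x + \<psi> x)"
  by (auto simp: group_cohomology_def FactGroup_def set_mult_def hom_class_eq bar_cochains_def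
      hom_cochain_def fun_eq_iff)

text \<open>The cohomology of the Aomoto complex in degree 1 is the annihilator of \<open>a\<close>
  modulo the line through \<open>a\<close>; it is nonzero when some annihilating \<open>b\<close> is
  off that line.\<close>

lemma resonance11_iff:
  assumes H: "group H" and a: "a \<in> hom H real_group"
  shows "hom_class H a \<in> resonance11 H \<longleftrightarrow>
    (\<exists>b\<in>hom H real_group. cup_trivial H b a \<and> \<not> (\<exists>k. \<forall>x\<in>carrier H. b x = k * a x))"
proof -
  define B where "B = range (\<lambda>k. hom_class H (\<lambda>x. k * a x))"
  define Z where "Z = hom_class H ` {b \<in> hom H real_group. cup_trivial H b a}"
  have Z: "{b \<in> carrier (group_cohomology H 1). cup H 1 1 b (hom_class H a) = \<one>\<^bsub>group_cohomology H (1 + 1)\<^esub>} = Z"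
    using cup_hom_class_eq_one[OF H] by (simp only: carrier_cohomology_1[OF H] Z_def) blast
  have A: "aomoto_cohomology H 1 (hom_class H a) = (group_cohomology H 1)\<lparr>carrier := Z\<rparr> Mod B"
    unfolding aomoto_cohomology_def Z using cup_0_image[of H a] by (simp add: B_def)
  have one: "\<one>\<^bsub>aomoto_cohomology H 1 (hom_class H a)\<^esub> = B"
    unfolding A by (simp add: FactGroup_def)
  define T where "T b = range (\<lambda>k. hom_class H (\<lambda>x. k * a x + b x))" for b
  have car: "carrier (aomoto_cohomology H 1 (hom_class H a)) = T ` {b \<in> hom H real_group. cup_trivial H b a}"
    unfolding A
    by (auto simp: FactGroup_def RCOSETS_def r_coset_def B_def Z_def T_def hom_class_mult[simplified])
  have T: "T b = B \<longleftrightarrow> (\<exists>k. \<forall>x\<in>carrier H. b x = k * a x)" for b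
  proof
    assume "T b = B"
    moreover have "hom_class H (\<lambda>x. 0 * a x + b x) \<in> T b" unfolding T_def by blast
    ultimately obtain k where "hom_class H (\<lambda>x. 0 * a x + b x) = hom_class H (\<lambda>x. k * a x)"
      by (auto simp: B_def)
    then show "\<exists>k. \<forall>x\<in>carrier H. b x = k * a x" by (auto simp: hom_class_eq hom_cochain_eq_iff)
  next
    assume "\<exists>k. \<forall>x\<in>carrier H. b x = k * a x"
    then obtain k where k: "\<forall>x\<in>carrier H. b x = k * a x" by blast
    have e: "hom_class H (\<lambda>x. l * a x + b x) = hom_class H (\<lambda>x. (l + k) * a x)" for l
      using k by (auto simp: hom_class_eq hom_cochain_eq_iff algebra_simps)
    have "surj (\<lambda>l. l + k)" by (rule surjI[of _ "\<lambda>l. l - k"]) simp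
    moreover have "T b = (\<lambda>l. hom_class H (\<lambda>x. l * a x)) ` range (\<lambda>l. l + k)"
      unfolding T_def e by (simp only: image_image)
    ultimately show "T b = B" unfolding B_def by simp
  qed
  \<comment> \<open>The zero character makes the quotient nonempty, so differing from
    \<open>{B}\<close> means having an element other than \<open>B\<close>.\<close>
  have "(\<lambda>x. 0) \<in> hom H real_group" by (auto intro: hom_realI)
  moreover have "cup_trivial H (\<lambda>x. 0) a" by (auto simp: cup_trivial_def intro!: exI[of _ "\<lambda>_. 0"])
  ultimately have ne: "carrier (aomoto_cohomology H 1 (hom_class H a)) \<noteq> {}" unfolding car by blast
  have "hom_class H a \<in> resonance11 H \<longleftrightarrow> (\<exists>X\<in>carrier (aomoto_cohomology H 1 (hom_class H a)). X \<noteq> B)"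
  proof -
    have "C \<noteq> {} \<Longrightarrow> C \<noteq> {B} \<longleftrightarrow> (\<exists>X\<in>C. X \<noteq> B)" for C
      by (metis insertI1 singletonD subset_singletonD subsetI)
    from this[OF ne] show ?thesis
      unfolding resonance11_def mem_Collect_eq one carrier_cohomology_1[OF H] using imageI[OF a, of "hom_class H"] by simp
  qed
  then show ?thesis unfolding car by (auto simp: T)
qed


section \<open>Pairing rational chains with real cochains\<close>

definition chain_pairing :: "('a list \<Rightarrow> real) \<Rightarrow> ('a list \<Rightarrow>\<^sub>0 rat) \<Rightarrow> real" where
  "chain_pairing f c = (\<Sum>xs\<in>Poly_Mapping.keys c. of_rat (Poly_Mapping.lookup c xs) * f xs)"

lemma keys_sum_superset:
  assumes "finite A" "Poly_Mapping.keys c \<subseteq> A" "\<And>xs. F xs 0 = 0"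
  shows "(\<Sum>xs\<in>Poly_Mapping.keys c. F xs (Poly_Mapping.lookup c xs)) = (\<Sum>xs\<in>A. F xs (Poly_Mapping.lookup c xs))"
  using assms by (intro sum.mono_neutral_left) (auto simp: in_keys_iff)

text \<open>Cancellation may shrink the keys of \<open>c + d\<close>; since \<open>F\<close>
  vanishes at coefficient 0, all three sums can be taken over the union of the keys.\<close>

lemma keys_sum_add:
  fixes F :: "'k \<Rightarrow> 'q::comm_monoid_add \<Rightarrow> 'b::comm_monoid_add"
  assumes F: "\<And>xs. F xs 0 = 0" "\<And>xs q r. F xs (q + r) = F xs q + F xs r"
  shows "(\<Sum>xs\<in>Poly_Mapping.keys (c + d). F xs (Poly_Mapping.lookup (c + d) xs)) =
    (\<Sum>xs\<in>Poly_Mapping.keys c. F xs (Poly_Mapping.lookup c xs)) +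
    (\<Sum>xs\<in>Poly_Mapping.keys d. F xs (Poly_Mapping.lookup d xs))"
proof -
  let ?A = "Poly_Mapping.keys c \<union> Poly_Mapping.keys d"
  have "Poly_Mapping.keys (c + d) \<subseteq> ?A" by (rule Poly_Mapping.keys_add)
  then show ?thesis
    using keys_sum_superset[of ?A "c + d" F] keys_sum_superset[of ?A c F] keys_sum_superset[of ?A d F] F
    by (simp add: lookup_add sum.distrib)
qed

lemma chain_pairing_add: "chain_pairing f (c + d) = chain_pairing f c + chain_pairing f d"
  unfolding chain_pairing_def
  by (rule keys_sum_add[where F = "\<lambda>xs q. of_rat q * f xs"]) (auto simp: of_rat_add algebra_simps)

lemma chain_pairing_0 [simp]: "chain_pairing f 0 = 0"
  by (simp add: chain_pairing_def)

lemma chain_pairing_uminus: "chain_pairing f (- c) = - chain_pairing f c"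
  using chain_pairing_add[of f c "- c"] by simp

lemma chain_pairing_diff: "chain_pairing f (c - d) = chain_pairing f c - chain_pairing f d"
  using chain_pairing_add[of f c "- d"] by (simp add: chain_pairing_uminus)

lemma chain_pairing_single: "chain_pairing f (Poly_Mapping.single xs q) = of_rat q * f xs"
  by (cases "q = 0") (auto simp: chain_pairing_def)

lemma chain_pairing_sum: "chain_pairing f (\<Sum>i\<in>I. c i) = (\<Sum>i\<in>I. chain_pairing f (c i))"
  by (induction I rule: infinite_finite_induct) (auto simp: chain_pairing_add)

lemma chain_pairing_diff_cochain:
  "chain_pairing (\<lambda>xs. f xs - h xs) c = chain_pairing f c - chain_pairing h c"
  by (simp add: chain_pairing_def sum_subtractf algebra_simps)

lemma chain_pairing_cong:
  "Poly_Mapping.keys c \<subseteq> A \<Longrightarrow> (\<And>xs. xs \<in> A \<Longrightarrow> f xs = h xs) \<Longrightarrow> chain_pairing f c = chain_pairing h c"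
  unfolding chain_pairing_def by (intro sum.cong) auto

text \<open>Boundary and coboundary use the same faces with the same signs, so they are
  adjoint.\<close>

lemma chain_pairing_boundary:
  assumes "Poly_Mapping.keys c \<subseteq> tuples H (Suc n)"
  shows "chain_pairing f (bar_boundary H (Suc n) c) = chain_pairing (bar_coboundary H n f) c"
proof -
  have "chain_pairing f (bar_boundary H (Suc n) c) = (\<Sum>xs\<in>Poly_Mapping.keys c. \<Sum>i\<le>Suc n.
      of_rat ((-1) ^ i * Poly_Mapping.lookup c xs) * f (bar_face H i xs))"
    by (simp add: bar_boundary_def chain_pairing_sum chain_pairing_single chain_pairing_add)
  also have "\<dots> = chain_pairing (bar_coboundary H n f) c"
    unfolding chain_pairing_def
  proof (rule sum.cong)
    fix xs assume "xs \<in> Poly_Mapping.keys c"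
    then have "bar_coboundary H n f xs = (\<Sum>i\<le>Suc n. (-1) ^ i * f (bar_face H i xs))"
      using assms by (auto simp: bar_coboundary_def)
    then show "(\<Sum>i\<le>Suc n. of_rat ((-1) ^ i * Poly_Mapping.lookup c xs) * f (bar_face H i xs)) =
        of_rat (Poly_Mapping.lookup c xs) * bar_coboundary H n f xs"
      by (simp only: sum_distrib_left) (simp add: of_rat_mult of_rat_power of_rat_minus mult_ac)
  qed simp
  finally show ?thesis .
qed

lemma chain_pairing_push: "chain_pairing f (bar_push h c) = chain_pairing (\<lambda>xs. f (map h xs)) c"
  unfolding bar_push_def chain_pairing_sum chain_pairing_single by (simp add: chain_pairing_def)

section \<open>Trivial action in terms of cycles and cocycles\<close>

lemma keys_bar_chains: "c \<in> carrier (bar_chains H n) \<longleftrightarrow> Poly_Mapping.keys c \<subseteq> tuples H n"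
  by (simp add: bar_chains_def)

text \<open>The pushforward of \<open>z\<close> lies in the image of the coset of \<open>z\<close>,
  which is that same coset.\<close>

lemma trivial_conj_action_cycle:
  assumes triv: "trivial_conj_action G K n" and g: "g \<in> carrier G"
    and z: "z \<in> bar_cycles (G\<lparr>carrier := K\<rparr>) n"
  shows "\<exists>d\<in>carrier (bar_chains (G\<lparr>carrier := K\<rparr>) (Suc n)).
    bar_push (\<lambda>x. g \<otimes>\<^bsub>G\<^esub> x \<otimes>\<^bsub>G\<^esub> inv\<^bsub>G\<^esub> g) z = bar_boundary (G\<lparr>carrier := K\<rparr>) (Suc n) d + z"
proof -
  let ?H = "G\<lparr>carrier := K\<rparr>" and ?c = "\<lambda>x. g \<otimes>\<^bsub>G\<^esub> x \<otimes>\<^bsub>G\<^esub> inv\<^bsub>G\<^esub> g"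
  have coset: "bar_boundaries ?H n #>\<^bsub>bar_chains ?H n\<^esub> c = {b + c |b. b \<in> bar_boundaries ?H n}" for c
    by (auto simp: r_coset_def bar_chains_def)
  have "bar_boundary ?H (Suc n) 0 = 0" by (simp add: bar_boundary_def)
  moreover have "0 \<in> carrier (bar_chains ?H (Suc n))" by (simp add: bar_chains_def)
  ultimately have 0: "0 \<in> bar_boundaries ?H n" unfolding bar_boundaries_def by (metis imageI)
  let ?X = "bar_boundaries ?H n #>\<^bsub>bar_chains ?H n\<^esub> z"
  have "?X \<in> carrier (group_homology ?H n)"
    using z by (auto simp: group_homology_def FactGroup_def RCOSETS_def r_coset_def)
  then have X: "homology_map ?H n ?c ?X = ?X"
    using triv g unfolding trivial_conj_action_def by blast
  have "z \<in> ?X" unfolding coset using 0 by force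
  moreover have "bar_push ?c z \<in> bar_boundaries ?H n #>\<^bsub>bar_chains ?H n\<^esub> bar_push ?c z"
    unfolding coset using 0 by force
  ultimately have "bar_push ?c z \<in> homology_map ?H n ?c ?X" unfolding homology_map_def by blast
  then have "bar_push ?c z \<in> {b + z |b. b \<in> bar_boundaries ?H n}" using X coset by simp
  then show ?thesis by (auto simp: bar_boundaries_def)
qed

text \<open>A cycle and its conjugate differ by a boundary, on which a cocycle vanishes.\<close>

lemma trivial_conj_action_pairing:
  assumes "trivial_conj_action G K n" "g \<in> carrier G" "z \<in> bar_cycles (G\<lparr>carrier := K\<rparr>) n"
    and f: "\<And>xs. xs \<in> tuples (G\<lparr>carrier := K\<rparr>) (Suc n) \<Longrightarrow> bar_coboundary (G\<lparr>carrier := K\<rparr>) n f xs = 0"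
  shows "chain_pairing (\<lambda>xs. f (map (\<lambda>x. g \<otimes>\<^bsub>G\<^esub> x \<otimes>\<^bsub>G\<^esub> inv\<^bsub>G\<^esub> g) xs)) z = chain_pairing f z"
proof -
  let ?H = "G\<lparr>carrier := K\<rparr>"
  obtain d where d: "d \<in> carrier (bar_chains ?H (Suc n))"
    "bar_push (\<lambda>x. g \<otimes>\<^bsub>G\<^esub> x \<otimes>\<^bsub>G\<^esub> inv\<^bsub>G\<^esub> g) z = bar_boundary ?H (Suc n) d + z"
    using trivial_conj_action_cycle[OF assms(1-3)] by blast
  have keys: "Poly_Mapping.keys d \<subseteq> tuples ?H (Suc n)" using d(1) by (simp add: keys_bar_chains)
  have "chain_pairing (bar_coboundary ?H n f) d = chain_pairing (\<lambda>_. 0) d"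
    using f by (rule chain_pairing_cong[OF keys])
  then have "chain_pairing f (bar_boundary ?H (Suc n) d) = 0"
    using chain_pairing_boundary[OF keys, of f] by (simp add: chain_pairing_def)
  then show ?thesis
    by (simp add: d(2) chain_pairing_add flip: chain_pairing_push)
qed

section \<open>Rational chains as a vector space, and detecting real coboundaries on cycles\<close>

definition chain_scale :: "rat \<Rightarrow> ('k \<Rightarrow>\<^sub>0 rat) \<Rightarrow> ('k \<Rightarrow>\<^sub>0 rat)" where
  "chain_scale q c = Poly_Mapping.map ((*) q) c"

lemma lookup_chain_scale: "Poly_Mapping.lookup (chain_scale q c) k = q * Poly_Mapping.lookup c k"
  by (simp add: chain_scale_def Poly_Mapping.map.rep_eq when_def)

lemma chain_scale_single: "chain_scale q (Poly_Mapping.single k r) = Poly_Mapping.single k (q * r)"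
  by (rule poly_mapping_eqI) (auto simp: lookup_chain_scale lookup_single when_def)

lemma vector_space_chain_scale: "vector_space chain_scale"
  by unfold_locales (auto intro!: poly_mapping_eqI simp: lookup_chain_scale lookup_add algebra_simps)

interpretation chain: vector_space_pair chain_scale chain_scale
  by (intro vector_space_pair.intro vector_space_chain_scale)

lemma bar_boundary_add: "bar_boundary H (Suc n) (c + d) = bar_boundary H (Suc n) c + bar_boundary H (Suc n) d"
proof -
  let ?F = "\<lambda>xs q. \<Sum>i\<le>Suc n. Poly_Mapping.single (bar_face H i xs) ((-1) ^ i * q)"
  have "bar_boundary H (Suc n) c = (\<Sum>xs\<in>Poly_Mapping.keys c. ?F xs (Poly_Mapping.lookup c xs))" for c
    by (simp add: bar_boundary_def)
  then show ?thesis
    by (simp only:) (rule keys_sum_add, simp, simp add: single_add sum.distrib distrib_left)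
qed

lemma bar_boundary_scale: "bar_boundary H (Suc n) (chain_scale q c) = chain_scale q (bar_boundary H (Suc n) c)"
proof (cases "q = 0")
  case True
  have "chain_scale 0 d = 0" for d :: "'k \<Rightarrow>\<^sub>0 rat" by (rule poly_mapping_eqI) (simp add: lookup_chain_scale)
  then show ?thesis using True by (simp add: bar_boundary_def)
next
  case False
  then have keys: "Poly_Mapping.keys (chain_scale q c) = Poly_Mapping.keys c"
    by (auto simp: in_keys_iff lookup_chain_scale)
  show ?thesis
    unfolding bar_boundary_def keys
    by (simp add: lookup_chain_scale chain.vs1.scale_sum_right chain_scale_single
        chain.vs1.scale_right_distrib mult_ac)
qed

text \<open>The rational boundary map has a linear section over its image; evaluating \<open>u\<close> on that
  section gives the required cochain, since \<open>u\<close> does not see cycles.\<close>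

lemma coboundary_if_pairing_zero:
  assumes H: "group H"
    and u: "\<And>z. z \<in> bar_cycles H 2 \<Longrightarrow> chain_pairing u z = 0"
  obtains \<eta> where "\<And>x y. x \<in> carrier H \<Longrightarrow> y \<in> carrier H \<Longrightarrow> u [x, y] = \<eta> y - \<eta> (x \<otimes>\<^bsub>H\<^esub> y) + \<eta> x"
proof -
  interpret group H by fact
  let ?C = "carrier (bar_chains H 2)" and ?d = "bar_boundary H 2"
  have two: "2 = Suc (Suc 0)" by simp
  have lin: "Vector_Spaces.linear chain_scale chain_scale ?d"
    by (auto simp: Vector_Spaces.linear_iff vector_space_chain_scale two bar_boundary_add bar_boundary_scale)
  have sub: "chain.vs1.subspace ?C"
  proof (rule chain.vs1.subspaceI)
    fix c d assume "c \<in> ?C" "d \<in> ?C"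
    then show "c + d \<in> ?C" using Poly_Mapping.keys_add[of c d] by (auto simp: keys_bar_chains)
  next
    fix q c assume "c \<in> ?C"
    then show "chain_scale q c \<in> ?C" by (auto simp: keys_bar_chains in_keys_iff lookup_chain_scale)
  qed (simp add: keys_bar_chains)
  obtain s where s: "range s \<subseteq> ?C" "Vector_Spaces.linear chain_scale chain_scale s"
    "\<And>c. c \<in> ?C \<Longrightarrow> ?d (s (?d c)) = ?d c"
    using chain.linear_exists_right_inverse_on[OF lin sub] by blast
  define F where "F c = chain_pairing u (s c)" for c
  have F_add: "F (c + d) = F c + F d" for c d
    using chain.linear_add[OF s(2)] by (simp add: F_def chain_pairing_add)
  have F_diff: "F (c - d) = F c - F d" for c d
    using F_add[of "c - d" d] by simp
  have F_d: "F (?d c) = chain_pairing u c" if c: "c \<in> ?C" for c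
  proof -
    have "s (?d c) - c \<in> ?C" using s(1) c by (intro chain.vs1.subspace_diff[OF sub]) auto
    moreover have "?d (s (?d c) - c) = 0" using s(3)[OF c] by (simp add: chain.linear_diff[OF lin])
    ultimately have "chain_pairing u (s (?d c) - c) = 0" by (intro u) (simp add: bar_cycles_def)
    then show ?thesis by (simp add: F_def chain_pairing_diff)
  qed
  show ?thesis
  proof (rule that[of "\<lambda>x. F (Poly_Mapping.single [x] 1)"])
    fix x y assume xy: "x \<in> carrier H" "y \<in> carrier H"
    have "Poly_Mapping.single [x, y] 1 \<in> ?C" using xy by (auto simp: keys_bar_chains two tuples_2)
    moreover have "?d (Poly_Mapping.single [x, y] 1) =
        Poly_Mapping.single [y] 1 - Poly_Mapping.single [x \<otimes>\<^bsub>H\<^esub> y] 1 + Poly_Mapping.single [x] 1"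
      by (simp add: bar_boundary_def two bar_face_def single_uminus)
    ultimately show "u [x, y] = F (Poly_Mapping.single [y] 1) - F (Poly_Mapping.single [x \<otimes>\<^bsub>H\<^esub> y] 1) +
        F (Poly_Mapping.single [x] 1)"
      using F_d[of "Poly_Mapping.single [x, y] 1"] by (simp add: F_add F_diff chain_pairing_single)
  qed
qed


section \<open>Cup products on the kernel\<close>

lemma hom_real_int_pow:
  assumes "group G" "\<phi> \<in> hom G real_group" "x \<in> carrier G"
  shows "\<phi> (x [^]\<^bsub>G\<^esub> (k::int)) = of_int k * \<phi> x"
proof -
  interpret group G by fact
  have nat: "\<phi> (x [^]\<^bsub>G\<^esub> n) = real n * \<phi> x" for n :: nat
    by (induction n) (auto simp: hom_real_one[OF assms(1,2)] hom_real_mult[OF assms(1,2)] assms(3) algebra_simps)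
  show ?thesis
  proof (cases k rule: int_cases2)
    case (nonneg n)
    then show ?thesis using nat by (simp add: int_pow_int)
  next
    case (nonpos n)
    then show ?thesis using nat assms(3) by (simp add: int_pow_neg_int hom_real_inv[OF assms(1,2)])
  qed
qed

context raag_epi
begin

text \<open>The equation \<open>a \<union> b = \<chi> \<union> c\<close> in \<open>H\<^sup>2(G)\<close>, which has a basis indexed by the edges; a function \<open>\<eta>\<close>
  with \<open>twisted a b c \<eta>\<close> is a cochain on \<open>G\<close> that witnesses it.\<close>

definition wedge_rel :: "('v \<Rightarrow> real) \<Rightarrow> ('v \<Rightarrow> real) \<Rightarrow> ('v \<Rightarrow> real) \<Rightarrow> bool" where
  "wedge_rel a b c \<longleftrightarrow> (\<forall>(v, w)\<in>parcs \<Gamma>. a v * b w - a w * b v = ht v * c w - ht w * c v)"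

definition twisted :: "('v \<Rightarrow> real) \<Rightarrow> ('v \<Rightarrow> real) \<Rightarrow> ('v \<Rightarrow> real) \<Rightarrow> ('v word set \<Rightarrow> real) \<Rightarrow> bool" where
  "twisted a b c \<eta> \<longleftrightarrow> (\<forall>x\<in>carrier G. \<forall>y\<in>carrier G.
     \<eta> (x \<otimes>\<^bsub>G\<^esub> y) = \<eta> x + \<eta> y - lin \<Gamma> a x * lin \<Gamma> b y + \<chi> x * lin \<Gamma> c y)"

text \<open>A Heisenberg-like action on triples: the first two coordinates record
  \<open>lin \<Gamma> a\<close> and \<chi>, the third accumulates the twisted terms. The maps for
  \<open>v\<close> and \<open>w\<close> commute exactly when the equation of
  \<open>wedge_rel\<close> holds at that pair.\<close>

lemma twisted_exists:
  assumes "wedge_rel a b c"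
  shows "\<exists>\<eta>. twisted a b c \<eta>"
proof -
  define f where "f v = (\<lambda>(A::real, H::real, r::real). (A + a v, H + ht v, r - A * b v + H * c v))" for v
  define fi where "fi v = (\<lambda>(A::real, H::real, r::real).
    (A - a v, H - ht v, r + (A - a v) * b v - (H - ht v) * c v))" for v
  have f_app: "f v (A, H, r) = (A + a v, H + ht v, r - A * b v + H * c v)" for v A H r
    by (simp add: f_def)
  have fi_app: "fi v (A, H, r) = (A - a v, H - ht v, r + (A - a v) * b v - (H - ht v) * c v)" for v A H r
    by (simp add: fi_def)
  have comp: "f v \<circ> fi v = id" "fi v \<circ> f v = id" for v
    by (auto simp: f_def fi_def fun_eq_iff algebra_simps)
  have bij: "bij (f v)" for v using comp by (metis o_bij)
  have inv: "Hilbert_Choice.inv (f v) = fi v" for v using comp by (metis inv_unique_comp)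
  have f: "commuting_perms \<Gamma> f" unfolding commuting_perms_def
  proof (intro conjI ballI bij, clarify)
    fix v w assume "(v, w) \<in> parcs \<Gamma>"
    then have "a v * b w - a w * b v = ht v * c w - ht w * c v" using assms by (auto simp: wedge_rel_def)
    then show "f v \<circ> f w = f w \<circ> f v" by (auto simp: f_def fun_eq_iff algebra_simps)
  qed
  \<comment> \<open>The third coordinate of the image of the origin; comparing the action of a
    product with two successive actions gives the twisted formula.\<close>
  define E where "E g = snd (snd (raag_act f g (0, 0, 0)))" for g
  have act: "raag_act f g (A, H, r) =
      (A + lin \<Gamma> a g, H + lin \<Gamma> ht g, r + E g - A * lin \<Gamma> b g + H * lin \<Gamma> c g)"
    if "g \<in> carrier G" for g A H r
    using that
  proof (induction arbitrary: A H r rule: raag_induct)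
    case one
    then show ?case by (simp add: E_def raag_act_one[OF f] lin_one)
  next
    case (gen v g)
    then show ?case
      by (simp add: E_def[of "_ \<otimes>\<^bsub>G\<^esub> _"] raag_act_mult[OF f] raag_act_gen[OF f] f_app lin_mult lin_gen
          finite_V algebra_simps)
  next
    case (inv_gen v g)
    then show ?case
      by (simp add: E_def[of "_ \<otimes>\<^bsub>G\<^esub> _"] raag_act_mult[OF f] raag_act_inv_gen[OF f] inv fi_app lin_mult
          lin_inv lin_gen finite_V algebra_simps)
  qed
  have "twisted a b c E" unfolding twisted_def
  proof (intro ballI)
    fix x y assume xy: "x \<in> carrier G" "y \<in> carrier G"
    show "E (x \<otimes>\<^bsub>G\<^esub> y) = E x + E y - lin \<Gamma> a x * lin \<Gamma> b y + \<chi> x * lin \<Gamma> c y"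
      unfolding E_def[of "x \<otimes>\<^bsub>G\<^esub> y"] raag_act_mult[OF f xy] act[OF xy(1)] act[OF xy(2)]
      by (simp add: chi_eq_lin xy)
  qed
  then show ?thesis by blast
qed

text \<open>The term with \<open>c\<close> is invisible on \<open>N\<close>, where \<chi> vanishes,
  but conjugation by an element with nonzero \<chi> brings it back.\<close>

lemma twisted_conj:
  assumes "twisted a b c \<eta>" and g: "g \<in> carrier G" and x: "x \<in> carrier N"
  shows "\<eta> (g \<otimes>\<^bsub>G\<^esub> x \<otimes>\<^bsub>G\<^esub> inv\<^bsub>G\<^esub> g) =
    \<eta> x + lin \<Gamma> a x * lin \<Gamma> b g - lin \<Gamma> a g * lin \<Gamma> b x + \<chi> g * lin \<Gamma> c x"
proof -
  have \<eta>: "\<eta> (x \<otimes>\<^bsub>G\<^esub> y) = \<eta> x + \<eta> y - lin \<Gamma> a x * lin \<Gamma> b y + \<chi> x * lin \<Gamma> c y"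
    if "x \<in> carrier G" "y \<in> carrier G" for x y using assms(1) that by (auto simp: twisted_def)
  have x': "x \<in> carrier G" "\<chi> x = 0" using x by (auto simp: carrier_N)
  have "\<eta> \<one>\<^bsub>G\<^esub> = 0" using \<eta>[of "\<one>\<^bsub>G\<^esub>" "\<one>\<^bsub>G\<^esub>"] by (simp add: lin_one chi_one)
  then have "\<eta> g + \<eta> (inv\<^bsub>G\<^esub> g) + lin \<Gamma> a g * lin \<Gamma> b g - \<chi> g * lin \<Gamma> c g = 0"
    using \<eta>[of g "inv\<^bsub>G\<^esub> g"] g by (simp add: lin_inv)
  then show ?thesis using g x'
    by (simp add: \<eta> lin_mult lin_inv chi_mult algebra_simps)
qed

lemma twisted_cup_trivial:
  "twisted a b c \<eta> \<Longrightarrow> x \<in> carrier N \<Longrightarrow> y \<in> carrier N \<Longrightarrow>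
    \<eta> (x \<otimes>\<^bsub>G\<^esub> y) = \<eta> x + \<eta> y - lin \<Gamma> a x * lin \<Gamma> b y"
  by (auto simp: twisted_def carrier_N)

lemma wedge_rel_cup_trivial:
  assumes "wedge_rel a b c"
  shows "cup_trivial N (lin \<Gamma> a) (lin \<Gamma> b)"
proof -
  obtain \<eta> where "twisted a b c \<eta>" using twisted_exists[OF assms] by blast
  then show ?thesis unfolding cup_trivial_def by (intro exI[of _ \<eta>]) (simp add: twisted_cup_trivial)
qed

section \<open>Splitting the group into \<open>N\<close> and the powers of a lift of 1\<close>

definition t where "t = (SOME g. g \<in> carrier G \<and> \<chi> g = 1)"

lemma t: "t \<in> carrier G" "\<chi> t = 1"
  using someI_ex[of "\<lambda>g. g \<in> carrier G \<and> \<chi> g = 1"] chi_onto unfolding t_def by auto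

lemma chi_real_hom: "(\<lambda>g. real_of_int (\<chi> g)) \<in> hom G real_group"
  by (rule hom_realI) (simp add: chi_mult)

lemma chi_t_pow: "\<chi> (t [^]\<^bsub>G\<^esub> (k::int)) = k"
  using hom_real_int_pow[OF group_raag chi_real_hom t(1), of k] t(2) by simp

definition proj_N :: "'v word set \<Rightarrow> 'v word set" where
  "proj_N g = g \<otimes>\<^bsub>G\<^esub> t [^]\<^bsub>G\<^esub> (- \<chi> g)"

lemma proj_N_in_N: "g \<in> carrier G \<Longrightarrow> proj_N g \<in> carrier N"
  using t by (simp add: carrier_N proj_N_def chi_mult chi_t_pow)

lemma proj_N_mult_pow: "g \<in> carrier G \<Longrightarrow> proj_N g \<otimes>\<^bsub>G\<^esub> t [^]\<^bsub>G\<^esub> (\<chi> g) = g"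
  using t by (simp add: proj_N_def G.m_assoc flip: G.int_pow_mult)

lemma proj_N_N: "x \<in> carrier N \<Longrightarrow> proj_N x = x"
  by (simp add: carrier_N proj_N_def)

text \<open>The multiplication rule of the semidirect product of \<open>N\<close> with the powers of
  \<open>t\<close>.\<close>

lemma proj_N_mult:
  assumes "g \<in> carrier G" "h \<in> carrier G"
  shows "proj_N (g \<otimes>\<^bsub>G\<^esub> h) =
    proj_N g \<otimes>\<^bsub>G\<^esub> (t [^]\<^bsub>G\<^esub> (\<chi> g) \<otimes>\<^bsub>G\<^esub> proj_N h \<otimes>\<^bsub>G\<^esub> inv\<^bsub>G\<^esub> (t [^]\<^bsub>G\<^esub> (\<chi> g)))"
proof -
  have c: "t [^]\<^bsub>G\<^esub> k \<in> carrier G" for k :: int using t by simp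
  have "proj_N g \<otimes>\<^bsub>G\<^esub> (t [^]\<^bsub>G\<^esub> (\<chi> g) \<otimes>\<^bsub>G\<^esub> proj_N h \<otimes>\<^bsub>G\<^esub> inv\<^bsub>G\<^esub> (t [^]\<^bsub>G\<^esub> (\<chi> g)))
    = (proj_N g \<otimes>\<^bsub>G\<^esub> t [^]\<^bsub>G\<^esub> (\<chi> g)) \<otimes>\<^bsub>G\<^esub> proj_N h \<otimes>\<^bsub>G\<^esub> t [^]\<^bsub>G\<^esub> (- \<chi> g)"
    using assms c proj_N_in_N N_in_G by (simp add: G.m_assoc G.int_pow_neg t)
  also have "\<dots> = g \<otimes>\<^bsub>G\<^esub> proj_N h \<otimes>\<^bsub>G\<^esub> t [^]\<^bsub>G\<^esub> (- \<chi> g)" using assms by (simp add: proj_N_mult_pow)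
  also have "\<dots> = g \<otimes>\<^bsub>G\<^esub> h \<otimes>\<^bsub>G\<^esub> (t [^]\<^bsub>G\<^esub> (- \<chi> h) \<otimes>\<^bsub>G\<^esub> t [^]\<^bsub>G\<^esub> (- \<chi> g))"
    using assms c by (simp add: proj_N_def G.m_assoc)
  also have "\<dots> = proj_N (g \<otimes>\<^bsub>G\<^esub> h)"
    using assms t by (simp add: proj_N_def chi_mult algebra_simps flip: G.int_pow_mult)
  finally show ?thesis by simp
qed

lemma lin_proj_N: "g \<in> carrier G \<Longrightarrow> lin \<Gamma> c (proj_N g) = lin \<Gamma> c g - \<chi> g * lin \<Gamma> c t"
  using t by (simp add: proj_N_def lin_mult hom_real_int_pow[OF group_raag lin_hom])

text \<open>Characters trivial on \<open>N\<close> are multiples of \<chi>. Evaluating at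
  \<open>proj_N (gen \<Gamma> v)\<close> shows that the factor is the difference of the two values
  at \<open>t\<close>.\<close>

lemma lin_eq_on_N_iff:
  "(\<forall>x\<in>carrier N. lin \<Gamma> c x = lin \<Gamma> d x) \<longleftrightarrow> (\<exists>k. \<forall>v\<in>V. c v = d v + k * ht v)"
proof
  assume eq: "\<forall>x\<in>carrier N. lin \<Gamma> c x = lin \<Gamma> d x"
  have "c v = d v + (lin \<Gamma> c t - lin \<Gamma> d t) * ht v" if "v \<in> V" for v
  proof -
    have g: "gen \<Gamma> v \<in> carrier G" using that by simp
    have "lin \<Gamma> c (proj_N (gen \<Gamma> v)) = lin \<Gamma> d (proj_N (gen \<Gamma> v))" using eq proj_N_in_N[OF g] by blast
    then show ?thesis using that by (simp add: lin_proj_N lin_gen finite_V ht_def algebra_simps)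
  qed
  then show "\<exists>k. \<forall>v\<in>V. c v = d v + k * ht v" by blast
next
  assume "\<exists>k. \<forall>v\<in>V. c v = d v + k * ht v"
  then obtain k where k: "\<forall>v\<in>V. c v = d v + k * ht v" by blast
  have "lin \<Gamma> c x = lin \<Gamma> d x" if "x \<in> carrier N" for x
  proof -
    have "lin \<Gamma> c x = lin \<Gamma> (\<lambda>v. 1 * d v + k * ht v) x" using k by (intro lin_cong) auto
    also have "\<dots> = lin \<Gamma> d x + k * lin \<Gamma> ht x" unfolding lin_lincomb by simp
    also have "lin \<Gamma> ht x = 0" using chi_eq_lin[of x] that by (simp add: carrier_N)
    finally show ?thesis by simp
  qed
  then show "\<forall>x\<in>carrier N. lin \<Gamma> c x = lin \<Gamma> d x" by blast
qed

lemma lin_hom_N: "lin \<Gamma> c \<in> hom N real_group"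
  by (rule hom_realI) (simp add: lin_mult N_in_G)

end

section \<open>Consequences of a trivial action on the first homology\<close>

locale raag_epi_trivial_H1 = raag_epi +
  assumes trivial_H1: "trivial_conj_action (raag \<Gamma>) (kernel (raag \<Gamma>) integer_group \<chi>) 1"
begin

text \<open>The chain \<open>[x]\<close> is a cycle and \<phi> is a cocycle, so their pairing
  \<open>\<phi> x\<close> is unchanged by conjugation.\<close>

lemma hom_conj:
  assumes \<phi>: "\<phi> \<in> hom N real_group" and g: "g \<in> carrier G" and x: "x \<in> carrier N"
  shows "\<phi> (g \<otimes>\<^bsub>G\<^esub> x \<otimes>\<^bsub>G\<^esub> inv\<^bsub>G\<^esub> g) = \<phi> x"
proof -
  let ?z = "Poly_Mapping.single [x] (1::rat)"
  have z: "?z \<in> bar_cycles N 1"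
    using x by (auto simp: bar_cycles_def keys_bar_chains tuples_1 bar_boundary_def bar_face_def single_uminus)
  have "hom_cochain N \<phi> \<in> bar_cocycles N 1" using \<phi> by (simp add: bar_cocycles_1[OF group_N])
  then have "bar_coboundary N 1 (hom_cochain N \<phi>) xs = 0" for xs by (simp add: bar_cocycles_def)
  then have "chain_pairing (\<lambda>xs. hom_cochain N \<phi> (map (\<lambda>x. g \<otimes>\<^bsub>G\<^esub> x \<otimes>\<^bsub>G\<^esub> inv\<^bsub>G\<^esub> g) xs)) ?z
      = chain_pairing (hom_cochain N \<phi>) ?z"
    using trivial_conj_action_pairing[OF trivial_H1[unfolded kernel_eq] g, unfolded N_eq, OF z] by blast
  then show ?thesis
    using x conj_in_N[OF g x] by (simp add: chain_pairing_single hom_cochain_def tuples_1)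
qed

text \<open>The conjugation in \<open>proj_N_mult\<close> is invisible to \<phi>, so composing
  \<phi> with \<open>proj_N\<close> is a character of the whole group; it is the extension that
  vanishes at \<open>t\<close>.\<close>

lemma hom_extends:
  assumes \<phi>: "\<phi> \<in> hom N real_group"
  obtains c where "\<And>x. x \<in> carrier N \<Longrightarrow> \<phi> x = lin \<Gamma> c x" "\<And>g. g \<in> carrier G \<Longrightarrow> \<phi> (proj_N g) = lin \<Gamma> c g"
proof -
  have "\<phi> (proj_N (g \<otimes>\<^bsub>G\<^esub> h)) = \<phi> (proj_N g) + \<phi> (proj_N h)" if gh: "g \<in> carrier G" "h \<in> carrier G" for g h
  proof -
    have tk: "t [^]\<^bsub>G\<^esub> (\<chi> g) \<in> carrier G" using t by simp
    have "\<phi> (proj_N (g \<otimes>\<^bsub>G\<^esub> h)) =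
        \<phi> (proj_N g) + \<phi> (t [^]\<^bsub>G\<^esub> (\<chi> g) \<otimes>\<^bsub>G\<^esub> proj_N h \<otimes>\<^bsub>G\<^esub> inv\<^bsub>G\<^esub> (t [^]\<^bsub>G\<^esub> (\<chi> g)))"
      using hom_real_mult[OF group_N \<phi> proj_N_in_N[OF gh(1)] conj_in_N[OF tk proj_N_in_N[OF gh(2)]]]
      by (simp add: proj_N_mult gh)
    then show ?thesis using hom_conj[OF \<phi> tk proj_N_in_N[OF gh(2)]] by simp
  qed
  then have hom: "(\<lambda>g. \<phi> (proj_N g)) \<in> hom G real_group" by (rule hom_realI)
  have "\<phi> (proj_N g) = lin \<Gamma> (\<lambda>v. \<phi> (proj_N (gen \<Gamma> v))) g" if "g \<in> carrier G" for g
    by (rule hom_eq_lin[OF finite_V hom that]) simp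
  note ext = this
  show ?thesis
  proof (rule that[of "\<lambda>v. \<phi> (proj_N (gen \<Gamma> v))"])
    fix x assume x: "x \<in> carrier N"
    show "\<phi> x = lin \<Gamma> (\<lambda>v. \<phi> (proj_N (gen \<Gamma> v))) x" using ext[OF N_in_G[OF x]] by (simp add: proj_N_N x)
  qed (rule ext)
qed

text \<open>With \<open>a = b = 0\<close> the twisted cochain is a character of \<open>N\<close>.
  Conjugation by \<open>t\<close> adds \<open>lin \<Gamma> c\<close> to it, which must therefore
  vanish on \<open>N\<close>.\<close>

lemma ht_wedge_zero:
  assumes "\<And>v w. (v, w) \<in> parcs \<Gamma> \<Longrightarrow> ht v * c w = ht w * c v"
  shows "\<exists>k. \<forall>v\<in>V. c v = k * ht v"
proof -
  have lin0: "lin \<Gamma> (\<lambda>v. 0) g = 0" for g by (simp add: lin_def)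
  have "wedge_rel (\<lambda>v. 0) (\<lambda>v. 0) c" using assms by (auto simp: wedge_rel_def)
  then obtain \<eta> where \<eta>: "twisted (\<lambda>v. 0) (\<lambda>v. 0) c \<eta>" using twisted_exists by blast
  have hom: "\<eta> \<in> hom N real_group" by (rule hom_realI) (simp add: twisted_cup_trivial[OF \<eta>] lin0)
  then have "lin \<Gamma> c x = lin \<Gamma> (\<lambda>v. 0) x" if "x \<in> carrier N" for x
    using hom_conj[OF hom t(1) that] twisted_conj[OF \<eta> t(1) that] t(2) by (simp add: lin0)
  then show ?thesis using lin_eq_on_N_iff[of c "\<lambda>v. 0"] by auto
qed

text \<open>If the height vanished on \<open>W1\<close>, it would vanish at a vertex
  \<open>u\<close> of \<open>W1\<close> and at all its neighbours; the indicator of \<open>u\<close>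
  would then annihilate \<chi> without being a multiple of it.\<close>

lemma separated_cover_height_nonzero:
  assumes sep: "separated \<Gamma> W1 W2" and supp: "\<And>v. v \<in> V \<Longrightarrow> v \<notin> W1 \<union> W2 \<Longrightarrow> ht v = 0"
  shows "\<exists>v\<in>W1. ht v \<noteq> 0"
proof (rule ccontr)
  assume 0: "\<not> ?thesis"
  obtain u where u: "u \<in> W1" "u \<in> V" using sep by (auto simp: separated_def)
  have "\<exists>k. \<forall>v\<in>V. (if v = u then 1 else 0) = k * ht v"
  proof (rule ht_wedge_zero)
    fix v w assume vw: "(v, w) \<in> parcs \<Gamma>"
    have "ht v = 0" if "w = u" using that vw separatedD[OF sep vw] u 0 supp arcs_V[OF vw] by auto
    moreover have "ht w = 0" if "v = u" using that vw separatedD[OF sep vw] u 0 supp arcs_V[OF vw] by auto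
    ultimately show "ht v * (if w = u then 1 else 0) = ht w * (if v = u then 1 else 0)" by auto
  qed
  then show False using u 0 by force
qed

text \<open>Otherwise the restriction of the height to \<open>W1\<close> would annihilate \<chi>. It
  is not a multiple of \<chi>, because the height is nonzero somewhere on \<open>W1\<close> and
  somewhere on \<open>W2\<close>.\<close>

lemma separated_outside_support:
  assumes sep: "separated \<Gamma> W1 W2"
  shows "\<exists>v\<in>V - (W1 \<union> W2). ht v \<noteq> 0"
proof (rule ccontr)
  assume "\<not> ?thesis"
  then have supp: "\<And>v. v \<in> V \<Longrightarrow> v \<notin> W1 \<union> W2 \<Longrightarrow> ht v = 0" by blast
  obtain v1 where v1: "v1 \<in> W1" "ht v1 \<noteq> 0" using separated_cover_height_nonzero[OF sep supp] by blast
  obtain v2 where v2: "v2 \<in> W2" "ht v2 \<noteq> 0"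
    using separated_cover_height_nonzero[OF separated_sym[OF sep]] supp by blast
  have "\<exists>k. \<forall>v\<in>V. (if v \<in> W1 then ht v else 0) = k * ht v"
  proof (rule ht_wedge_zero)
    fix v w assume vw: "(v, w) \<in> parcs \<Gamma>"
    show "ht v * (if w \<in> W1 then ht w else 0) = ht w * (if v \<in> W1 then ht v else 0)"
      using separatedD[OF sep vw] supp arcs_V[OF vw] by (auto; metis mult_zero_left mult_zero_right UnE)
  qed
  then obtain k where k: "\<forall>v\<in>V. (if v \<in> W1 then ht v else 0) = k * ht v" by blast
  have "v1 \<in> V" "v2 \<in> V" "v2 \<notin> W1" using sep v1 v2 by (auto simp: separated_def)
  then have "ht v1 = k * ht v1" "0 = k * ht v2" using k v1 by fastforce+
  then show False using v1 v2 by simp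
qed

text \<open>The converse of \<open>wedge_rel_cup_trivial\<close>: \<eta> is carried to the whole
  group by \<open>proj_N\<close>, and its values on the two orders of a commuting pair of generators
  are compared.\<close>

lemma cup_trivial_wedge_rel:
  assumes "cup_trivial N (lin \<Gamma> a) (lin \<Gamma> b)"
  obtains c where "wedge_rel a b c"
proof -
  obtain \<eta> where \<eta>: "\<And>x y. x \<in> carrier N \<Longrightarrow> y \<in> carrier N \<Longrightarrow>
      \<eta> (x \<otimes>\<^bsub>G\<^esub> y) = \<eta> x + \<eta> y - lin \<Gamma> a x * lin \<Gamma> b y"
    using assms by (auto simp: cup_trivial_def)
  define cj where "cj g x = g \<otimes>\<^bsub>G\<^esub> x \<otimes>\<^bsub>G\<^esub> inv\<^bsub>G\<^esub> g" for g x
  have cjN: "cj g x \<in> carrier N" if "g \<in> carrier G" "x \<in> carrier N" for g x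
    using conj_in_N[OF that] by (simp add: cj_def)
  have lin_cj: "lin \<Gamma> d (cj g x) = lin \<Gamma> d x" if "g \<in> carrier G" "x \<in> carrier N" for d g x
    using hom_conj[OF lin_hom_N that] by (simp add: cj_def)
  have cj_mult: "cj g (x \<otimes>\<^bsub>G\<^esub> y) = cj g x \<otimes>\<^bsub>G\<^esub> cj g y"
    if "g \<in> carrier G" "x \<in> carrier G" "y \<in> carrier G" for g x y
  proof -
    have "inv\<^bsub>G\<^esub> g \<otimes>\<^bsub>G\<^esub> (g \<otimes>\<^bsub>G\<^esub> (y \<otimes>\<^bsub>G\<^esub> inv\<^bsub>G\<^esub> g)) = y \<otimes>\<^bsub>G\<^esub> inv\<^bsub>G\<^esub> g"
      using that G.m_assoc[of "inv\<^bsub>G\<^esub> g" g "y \<otimes>\<^bsub>G\<^esub> inv\<^bsub>G\<^esub> g"] by simp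
    then show ?thesis using that by (simp add: cj_def G.m_assoc)
  qed
  have cj_comp: "cj (g \<otimes>\<^bsub>G\<^esub> h) x = cj g (cj h x)"
    if "g \<in> carrier G" "h \<in> carrier G" "x \<in> carrier G" for g h x
    using that by (simp add: cj_def G.m_assoc G.inv_mult_group)
  \<comment> \<open>The change of \<eta> under conjugation. It is a character in \<open>x\<close>,
    because \<eta> and its conjugate satisfy the same product formula, and then also in
    \<open>g\<close>.\<close>
  define D where "D g x = \<eta> (cj g x) - \<eta> x" for g x
  have D_hom: "D g \<in> hom N real_group" if g: "g \<in> carrier G" for g
    by (rule hom_realI) (use g in \<open>simp add: D_def cj_mult N_in_G \<eta> cjN lin_cj\<close>)
  have D_hom2: "(\<lambda>g. D g x) \<in> hom G real_group" if x: "x \<in> carrier N" for x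
  proof (rule hom_realI)
    fix g h assume gh: "g \<in> carrier G" "h \<in> carrier G"
    have "D g (cj h x) = D g x" using hom_conj[OF D_hom[OF gh(1)] gh(2) x] by (simp add: cj_def)
    then show "D (g \<otimes>\<^bsub>G\<^esub> h) x = D g x + D h x" using gh x by (simp add: D_def cj_comp N_in_G)
  qed
  have \<eta>_cj: "\<eta> (cj (t [^]\<^bsub>G\<^esub> k) x) = \<eta> x + of_int k * D t x" if "x \<in> carrier N" for k :: int and x
    using hom_real_int_pow[OF group_raag D_hom2[OF that] t(1), of k] by (simp add: D_def)
  obtain \<theta> where \<theta>: "\<And>g. g \<in> carrier G \<Longrightarrow> D t (proj_N g) = lin \<Gamma> \<theta> g"
    using hom_extends[OF D_hom[OF t(1)]] by metis
  define \<alpha> where "\<alpha> = lin \<Gamma> a t"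
  define \<beta> where "\<beta> = lin \<Gamma> b t"
  have proj: "\<eta> (proj_N (g \<otimes>\<^bsub>G\<^esub> h)) = \<eta> (proj_N g) + \<eta> (proj_N h) + \<chi> g * lin \<Gamma> \<theta> h -
      (lin \<Gamma> a g - \<chi> g * \<alpha>) * (lin \<Gamma> b h - \<chi> h * \<beta>)" if gh: "g \<in> carrier G" "h \<in> carrier G" for g h
  proof -
    have tk: "t [^]\<^bsub>G\<^esub> (\<chi> g) \<in> carrier G" using t by simp
    have "proj_N (g \<otimes>\<^bsub>G\<^esub> h) = proj_N g \<otimes>\<^bsub>G\<^esub> cj (t [^]\<^bsub>G\<^esub> (\<chi> g)) (proj_N h)"
      using gh by (simp add: proj_N_mult cj_def)
    then show ?thesis
      using gh tk by (simp add: \<eta> proj_N_in_N cjN \<eta>_cj lin_cj \<theta> lin_proj_N \<alpha>_def \<beta>_def)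
  qed
  \<comment> \<open>The terms with \<open>\<alpha>\<close> and \<open>\<beta>\<close> arise because
    \<open>proj_N\<close> removes the values at \<open>t\<close> from \<open>a\<close> and
    \<open>b\<close>; the product of both corrections is symmetric and cancels.\<close>
  have "wedge_rel a b (\<lambda>v. \<theta> v + \<alpha> * b v - \<beta> * a v)" unfolding wedge_rel_def
  proof clarify
    fix v w assume vw: "(v, w) \<in> parcs \<Gamma>"
    have V: "v \<in> V" "w \<in> V" using arcs_V[OF vw] by auto
    then have g: "gen \<Gamma> v \<in> carrier G" "gen \<Gamma> w \<in> carrier G" by auto
    show "a v * b w - a w * b v = ht v * (\<theta> w + \<alpha> * b w - \<beta> * a w) - ht w * (\<theta> v + \<alpha> * b v - \<beta> * a v)"
      using proj[OF g] proj[OF g(2,1)] raag_arc_commute[OF vw V]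
      by (simp add: lin_gen finite_V V algebra_simps flip: ht_def)
  qed
  then show ?thesis by (rule that)
qed

end

section \<open>Massey products under a trivial action on the second homology\<close>

locale raag_epi_trivial_H2 = raag_epi_trivial_H1 +
  assumes trivial_H2: "trivial_conj_action (raag \<Gamma>) (kernel (raag \<Gamma>) integer_group \<chi>) 2"
begin

text \<open>The cochain \<open>- a\<^sup>2/2 \<union> b + a \<union> \<eta>\<close> represents the Massey product \<open>\<langle>a, a, b\<rangle>\<close>; conjugation
  by \<open>t\<close> changes it by \<open>a \<union> c\<close> up to coboundaries.\<close>

lemma wedge_rel_cup_trivial_right:
  assumes "wedge_rel a b c"
  shows "cup_trivial N (lin \<Gamma> a) (lin \<Gamma> c)"
proof -
  obtain \<eta> where tw: "twisted a b c \<eta>" using twisted_exists[OF assms] by blast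
  note \<eta> = twisted_cup_trivial[OF tw]
  note \<eta>_conj = twisted_conj[OF tw t(1)]
  let ?a = "lin \<Gamma> a" and ?b = "lin \<Gamma> b" and ?c = "lin \<Gamma> c"
  let ?cj = "\<lambda>x. t \<otimes>\<^bsub>G\<^esub> x \<otimes>\<^bsub>G\<^esub> inv\<^bsub>G\<^esub> t"
  have two: "2 = Suc (Suc 0)" by simp
  define f where "f xs = - (?a (xs ! 0))\<^sup>2 / 2 * ?b (xs ! 1) + ?a (xs ! 0) * \<eta> (xs ! 1)" for xs
  \<comment> \<open>The change of \<open>f\<close> under conjugation by \<open>t\<close>: the
    product of \<open>a\<close> and \<open>c\<close>, plus multiples of the products of
    \<open>a\<close> with \<open>a\<close> and with \<open>b\<close>.\<close>
  define u where "u xs = ?a (xs ! 0) * (?b t * ?a (xs ! 1) - ?a t * ?b (xs ! 1) + ?c (xs ! 1))" for xs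
  have f_coc: "bar_coboundary N 2 f xs = 0" if "xs \<in> tuples N (Suc 2)" for xs
  proof -
    obtain x y z where xyz: "x \<in> carrier N" "y \<in> carrier N" "z \<in> carrier N" "xs = [x, y, z]"
      using \<open>xs \<in> tuples N (Suc 2)\<close> by (auto simp: two tuples_3)
    then show ?thesis
      by (simp add: two bar_coboundary_2 f_def \<eta> lin_mult N_in_G power2_eq_square field_simps)
  qed
  have conj_f: "f (map ?cj xs) - f xs = u xs" if "xs \<in> tuples N 2" for xs
  proof -
    obtain x y where xy: "x \<in> carrier N" "y \<in> carrier N" "xs = [x, y]"
      using \<open>xs \<in> tuples N 2\<close> by (auto simp: two tuples_2)
    have "?a (?cj x) = ?a x" "?b (?cj y) = ?b y" using hom_conj[OF lin_hom_N t(1)] xy by auto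
    then show ?thesis using xy t(2) by (simp add: f_def u_def \<eta>_conj algebra_simps)
  qed
  have "chain_pairing u z = 0" if z: "z \<in> bar_cycles N 2" for z
  proof -
    have "chain_pairing (\<lambda>xs. f (map ?cj xs)) z = chain_pairing f z"
      using trivial_conj_action_pairing[OF trivial_H2[unfolded kernel_eq] t(1), unfolded N_eq, OF z f_coc] .
    moreover have "chain_pairing u z = chain_pairing (\<lambda>xs. f (map ?cj xs) - f xs) z"
      using z by (intro chain_pairing_cong[of _ "tuples N 2"]) (auto simp: conj_f bar_cycles_def keys_bar_chains)
    ultimately show ?thesis by (simp add: chain_pairing_diff_cochain)
  qed
  then obtain \<zeta> where \<zeta>: "\<And>x y. x \<in> carrier N \<Longrightarrow> y \<in> carrier N \<Longrightarrow> u [x, y] = \<zeta> y - \<zeta> (x \<otimes>\<^bsub>G\<^esub> y) + \<zeta> x"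
    using coboundary_if_pairing_zero[OF group_N] by (metis mult_N)
  show ?thesis unfolding cup_trivial_def
  \<comment> \<open>The two added terms cancel the unwanted products in \<open>u\<close>:
    \<open>- a\<^sup>2 / 2\<close> is a primitive of the product of \<open>a\<close> with itself,
    and \<eta> of the product of \<open>a\<close> and \<open>b\<close>.\<close>
  proof (intro exI[of _ "\<lambda>x. \<zeta> x + ?b t * (?a x)\<^sup>2 / 2 + ?a t * \<eta> x"] ballI)
    fix x y assume xy: "x \<in> carrier N" "y \<in> carrier N"
    have "\<zeta> (x \<otimes>\<^bsub>G\<^esub> y) = \<zeta> x + \<zeta> y - ?a x * (?b t * ?a y - ?a t * ?b y + ?c y)"
      using \<zeta>[OF xy] by (simp add: u_def)
    then show "\<zeta> (x \<otimes>\<^bsub>N\<^esub> y) + ?b t * (?a (x \<otimes>\<^bsub>N\<^esub> y))\<^sup>2 / 2 + ?a t * \<eta> (x \<otimes>\<^bsub>N\<^esub> y) =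
      \<zeta> x + ?b t * (?a x)\<^sup>2 / 2 + ?a t * \<eta> x + (\<zeta> y + ?b t * (?a y)\<^sup>2 / 2 + ?a t * \<eta> y) - ?a x * ?c y"
      using xy by (simp add: \<eta> lin_mult N_in_G power2_eq_square field_simps)
  qed
qed

end


section \<open>Vanishing products and disconnected supports\<close>

text \<open>Gaussian elimination: a pivot \<open>j\<close> eliminates one equation and one
  unknown.\<close>

lemma homogeneous_system_solution:
  fixes M :: "'i \<Rightarrow> 'v \<Rightarrow> 'a::field"
  assumes "finite V" "finite I" "card V < card I"
  shows "\<exists>q. (\<exists>i\<in>I. q i \<noteq> 0) \<and> (\<forall>v\<in>V. (\<Sum>i\<in>I. q i * M i v) = 0)"
  using assms
proof (induction V arbitrary: I M rule: finite_induct)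
  case empty
  then obtain i where "i \<in> I" by fastforce
  then show ?case by (auto intro!: exI[of _ "\<lambda>_. 1"])
next
  case (insert v V)
  show ?case
  proof (cases "\<forall>i\<in>I. M i v = 0")
    case True
    have "card V < card I" using insert by simp
    then show ?thesis using insert.IH[OF insert.prems(1), of M] True by auto
  next
    case False
    then obtain j where j: "j \<in> I" "M j v \<noteq> 0" by blast
    let ?J = "I - {j}"
    have "card V < card ?J" using insert j by simp
    then obtain q where q: "\<exists>i\<in>?J. q i \<noteq> 0"
      "\<forall>u\<in>V. (\<Sum>i\<in>?J. q i * (M i u - M i v / M j v * M j u)) = 0"
      using insert.IH[of ?J "\<lambda>i u. M i u - M i v / M j v * M j u"] insert.prems(1) by auto
    define s where "s = (\<Sum>i\<in>?J. q i * M i v / M j v)"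
    \<comment> \<open>The coefficient at the pivot is solved from the equation at
      \<open>v\<close>.\<close>
    define p where "p = q(j := - s)"
    have sum_p: "(\<Sum>i\<in>I. p i * M i u) = (\<Sum>i\<in>?J. q i * M i u) - s * M j u" for u
    proof -
      have "(\<Sum>i\<in>I. p i * M i u) = p j * M j u + (\<Sum>i\<in>?J. p i * M i u)"
        by (rule sum.remove[OF insert.prems(1) j(1)])
      also have "(\<Sum>i\<in>?J. p i * M i u) = (\<Sum>i\<in>?J. q i * M i u)"
        by (rule sum.cong) (auto simp: p_def)
      finally show ?thesis by (simp add: p_def)
    qed
    have "(\<Sum>i\<in>I. p i * M i u) = 0" if "u \<in> insert v V" for u
    proof (cases "u = v")
      case True
      have "s * M j v = (\<Sum>i\<in>?J. q i * M i v)" using j by (simp add: s_def sum_distrib_right)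
      then show ?thesis by (simp add: sum_p True)
    next
      case False
      then have "(\<Sum>i\<in>?J. q i * (M i u - M i v / M j v * M j u)) = 0" using q(2) that by blast
      moreover have "s * M j u = (\<Sum>i\<in>?J. q i * (M i v / M j v * M j u))"
        by (simp add: s_def sum_distrib_right mult.assoc)
      ultimately show ?thesis by (simp only: sum_p right_diff_distrib sum_subtractf)
    qed
    moreover have "\<exists>i\<in>I. p i \<noteq> 0" using q(1) by (auto simp: p_def)
    ultimately show ?thesis by blast
  qed
qed

text \<open>The powers of the indeterminate are replaced by the terms of a sequence, so
  multiplication by the indeterminate becomes the shift.\<close>

definition poly_functional :: "'a::comm_ring_1 poly \<Rightarrow> (nat \<Rightarrow> 'a) \<Rightarrow> 'a" where
  "poly_functional p x = (\<Sum>i\<le>degree p. coeff p i * x i)"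

lemma poly_functional_bound:
  "degree p \<le> m \<Longrightarrow> poly_functional p x = (\<Sum>i\<le>m. coeff p i * x i)"
  unfolding poly_functional_def
  by (intro sum.mono_neutral_left) (auto simp: coeff_eq_0)

lemma poly_functional_linear_factor:
  "poly_functional ([:- z, 1:] * q) x = poly_functional q (\<lambda>i. x (Suc i)) - z * poly_functional q x"
proof -
  let ?m = "degree q"
  have "degree ([:- z, 1:] * q) \<le> Suc ?m"
    using degree_mult_le[of "[:- z, 1:]" q] by simp
  then have "poly_functional ([:- z, 1:] * q) x = (\<Sum>i\<le>Suc ?m. coeff ([:- z, 1:] * q) i * x i)"
    by (rule poly_functional_bound)
  also have "\<dots> = (\<Sum>i\<le>Suc ?m. coeff (pCons 0 q) i * x i) - (\<Sum>i\<le>Suc ?m. z * (coeff q i * x i))"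
    by (subst sum_subtractf[symmetric], rule sum.cong) (auto simp: algebra_simps)
  also have "(\<Sum>i\<le>Suc ?m. coeff (pCons 0 q) i * x i) = poly_functional q (\<lambda>i. x (Suc i))"
    unfolding sum.atMost_Suc_shift by (simp add: poly_functional_def)
  also have "(\<Sum>i\<le>Suc ?m. z * (coeff q i * x i)) = z * poly_functional q x"
    by (simp only: poly_functional_bound[of q "Suc ?m" x, OF le_SucI[OF order_refl]] sum_distrib_left)
  finally show ?thesis .
qed

text \<open>\<open>A\<close> and \<open>E\<close> are proportional along arcs but not globally.
  Normalising the ratio at one vertex, the vertices with that ratio and \<open>A\<close> nonzero are
  not adjacent to those violating it; at all others \<open>A\<close> vanishes. The field is general
  so that complex coefficients are allowed.\<close>

lemma separated_of_wedge_zero: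
  fixes A E :: "'v \<Rightarrow> 'a::field"
  assumes arcs: "\<And>v w. (v, w) \<in> parcs \<Gamma> \<Longrightarrow> A v * E w = A w * E v"
    and A: "\<exists>v\<in>pverts \<Gamma>. A v \<noteq> 0" and E: "\<not> (\<exists>k. \<forall>v\<in>pverts \<Gamma>. E v = k * A v)"
  shows "\<exists>W1 W2. separated \<Gamma> W1 W2 \<and> (\<forall>v\<in>pverts \<Gamma> - (W1 \<union> W2). A v = 0)"
proof -
  obtain v0 where v0: "v0 \<in> pverts \<Gamma>" "A v0 \<noteq> 0" using A by blast
  define k where "k = E v0 / A v0"
  define W1 where "W1 = {v \<in> pverts \<Gamma>. A v \<noteq> 0 \<and> E v = k * A v}"
  define W2 where "W2 = {v \<in> pverts \<Gamma>. E v \<noteq> k * A v}"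
  have no: False if "(v, w) \<in> parcs \<Gamma> \<or> (w, v) \<in> parcs \<Gamma>" "v \<in> W1" "w \<in> W2" for v w
  proof -
    have "A v * E w = A w * E v" using arcs that(1) by metis
    then have "A v * E w = A v * (k * A w)" using that(2) by (simp add: W1_def mult_ac)
    then show False using that(2,3) by (simp add: W1_def W2_def)
  qed
  have "v0 \<in> W1" using v0 by (simp add: W1_def k_def)
  moreover have "W2 \<noteq> {}" using E by (auto simp: W2_def)
  ultimately have "separated \<Gamma> W1 W2"
    using no by (auto simp: separated_def W1_def W2_def)
  moreover have "\<forall>v\<in>pverts \<Gamma> - (W1 \<union> W2). A v = 0" by (auto simp: W1_def W2_def)
  ultimately show ?thesis by blast
qed

section \<open>Iterating the passage from \<open>b\<close> to \<open>c\<close> and extracting an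
  eigenvector\<close>

context raag_epi_trivial_H2
begin

lemma wedge_sequence:
  assumes "cup_trivial N (lin \<Gamma> b) (lin \<Gamma> a)"
  obtains \<beta> where "\<beta> 0 = b" "\<And>n. wedge_rel a (\<beta> n) (\<beta> (Suc n))"
proof -
  obtain c where "wedge_rel b a c" using cup_trivial_wedge_rel[OF assms] .
  \<comment> \<open>Exchanging the two factors of the cup product changes the sign.\<close>
  then have c: "wedge_rel a b (\<lambda>v. - c v)" by (auto simp: wedge_rel_def algebra_simps)
  have step: "\<exists>z. wedge_rel a y z" if "wedge_rel a x y" for x y
    using wedge_rel_cup_trivial_right[OF that] cup_trivial_wedge_rel by blast
  define \<beta> where "\<beta> = rec_nat b (\<lambda>n x. SOME y. wedge_rel a x y)"
  have \<beta>: "\<beta> 0 = b" "\<beta> (Suc n) = (SOME y. wedge_rel a (\<beta> n) y)" for n by (auto simp: \<beta>_def)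
  have "wedge_rel a (\<beta> n) (\<beta> (Suc n))" for n
  proof (induction n)
    case 0
    show ?case unfolding \<beta> by (rule someI[of "wedge_rel a b", OF c])
  next
    case (Suc n)
    show ?case unfolding \<beta>(2)[of "Suc n"] using step[OF Suc] by (rule someI_ex)
  qed
  then show ?thesis using that \<beta>(1) by blast
qed

text \<open>A relation \<open>p\<close> of minimal degree between the \<open>\<beta> n\<close> modulo \<open>a\<close> and the height, divided by
  a linear factor, yields a class annihilated by \<open>a - z ht\<close> where \<open>z\<close> is a complex root of
  \<open>p\<close>; a vertex outside the support then forces \<open>z\<close> to be real.\<close>

lemma resonant_support:
  assumes cup: "cup_trivial N (lin \<Gamma> b) (lin \<Gamma> a)"
    and a: "\<not> (\<exists>k. \<forall>v\<in>V. a v = k * ht v)"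
    and b: "\<not> (\<exists>k l. \<forall>v\<in>V. b v = k * a v + l * ht v)"
  shows "\<exists>W1 W2 k. separated \<Gamma> W1 W2 \<and> (\<forall>v\<in>V - (W1 \<union> W2). a v = k * ht v)"
proof -
  obtain \<beta> where \<beta>: "\<beta> 0 = b" "\<And>n. wedge_rel a (\<beta> n) (\<beta> (Suc n))" using wedge_sequence[OF cup] by blast
  define x where "x v i = complex_of_real (\<beta> i v)" for v i
  define P where "P p \<longleftrightarrow> (\<exists>k l. \<forall>v\<in>V. poly_functional p (x v) = k * of_real (a v) + l * of_real (ht v))" for p
  \<comment> \<open>There are \<open>card V + 1\<close> vectors with \<open>card V\<close>
    coordinates, so they are dependent.\<close>
  obtain q where q: "\<exists>i\<in>{..card V}. q i \<noteq> 0" "\<forall>v\<in>V. (\<Sum>i\<le>card V. q i * x v i) = 0"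
    using homogeneous_system_solution[of V "{..card V}" "\<lambda>i v. x v i"] finite_V by auto
  define p0 where "p0 = (\<Sum>i\<le>card V. monom (q i) i)"
  have coeff_p0: "coeff p0 i = (if i \<le> card V then q i else 0)" for i
    by (simp add: p0_def coeff_sum)
  have "degree p0 \<le> card V" by (rule degree_le) (simp add: coeff_p0)
  then have "poly_functional p0 (x v) = 0" if "v \<in> V" for v
    using q(2) that by (simp add: poly_functional_bound coeff_p0)
  then have "P p0" unfolding P_def by (intro exI[of _ 0]) simp
  moreover have "p0 \<noteq> 0" using q(1) coeff_p0 by (metis atMost_iff coeff_0)
  ultimately obtain p where p: "p \<noteq> 0" "P p" and least: "\<And>r. r \<noteq> 0 \<Longrightarrow> P r \<Longrightarrow> degree p \<le> degree r"
    using ex_has_least_nat[of "\<lambda>r. r \<noteq> 0 \<and> P r" p0 degree] by blast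
  \<comment> \<open>A constant relation would put \<open>b\<close> in the complex span of
    \<open>a\<close> and the height; taking real parts contradicts the assumption on
    \<open>b\<close>.\<close>
  have deg: "degree p \<noteq> 0"
  proof
    assume "degree p = 0"
    then obtain c where c: "p = [:c:]" by (metis degree_eq_zeroE)
    obtain k l where kl: "\<And>v. v \<in> V \<Longrightarrow> c * of_real (b v) = k * of_real (a v) + l * of_real (ht v)"
      using p(2) by (auto simp: P_def c poly_functional_def x_def \<beta>(1))
    define k' l' where "k' = k / c" and "l' = l / c"
    have "b v = Re k' * a v + Re l' * ht v" if "v \<in> V" for v
    proof -
      have "complex_of_real (b v) = k' * of_real (a v) + l' * of_real (ht v)"
        using kl[OF that] p(1) by (simp add: c k'_def l'_def field_simps)
      then have "Re (complex_of_real (b v)) = Re (k' * of_real (a v) + l' * of_real (ht v))" by simp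
      then show ?thesis by simp
    qed
    then show False using b by blast
  qed
  then have "\<not> constant (poly p)" by (simp add: constant_degree)
  then obtain z where "poly p z = 0" using fundamental_theorem_of_algebra by blast
  then obtain r where r: "p = [:- z, 1:] * r" by (auto simp: poly_eq_0_iff_dvd)
  have r0: "r \<noteq> 0" using p(1) r by auto
  have "degree p = degree [:- z, 1:] + degree r" unfolding r by (rule degree_mult_eq) (use r0 in auto)
  then have nP: "\<not> P r" using least[OF r0] by auto
  define e where "e v = poly_functional r (x v)" for v
  define s where "s v = poly_functional r (\<lambda>i. x v (Suc i))" for v
  \<comment> \<open>Modulo \<open>a\<close> and the height, the shift multiplies \<open>e\<close> by
    \<open>z\<close>; minimality of \<open>p\<close> keeps \<open>e\<close> itself from lying in
    their span.\<close>
  obtain k l where kl: "\<And>v. v \<in> V \<Longrightarrow> s v - z * e v = k * of_real (a v) + l * of_real (ht v)"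
    using p(2) unfolding P_def r poly_functional_linear_factor e_def s_def by blast
  define A where "A v = of_real (a v) - z * of_real (ht v)" for v
  \<comment> \<open>The added multiple of the height cancels the contribution of
    \<open>k * a\<close> to the shifted sequence \<open>s\<close>.\<close>
  define E where "E v = e v + k * of_real (ht v)" for v
  have "\<exists>W1 W2. separated \<Gamma> W1 W2 \<and> (\<forall>v\<in>V - (W1 \<union> W2). A v = 0)"
  proof (rule separated_of_wedge_zero[of _ _ E])
    fix v w assume vw: "(v, w) \<in> parcs \<Gamma>"
    have "of_real (a v) * x w i - of_real (a w) * x v i =
        of_real (ht v) * x w (Suc i) - of_real (ht w) * x v (Suc i)" for i
    proof -
      have "a v * \<beta> i w - a w * \<beta> i v = ht v * \<beta> (Suc i) w - ht w * \<beta> (Suc i) v"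
        using \<beta>(2)[of i] vw by (auto simp: wedge_rel_def)
      then have "complex_of_real (a v * \<beta> i w - a w * \<beta> i v) =
          of_real (ht v * \<beta> (Suc i) w - ht w * \<beta> (Suc i) v)" by (rule arg_cong)
      then show ?thesis by (simp add: x_def)
    qed
    then have "(\<Sum>i\<le>degree r. coeff r i * (of_real (a v) * x w i - of_real (a w) * x v i)) =
        (\<Sum>i\<le>degree r. coeff r i * (of_real (ht v) * x w (Suc i) - of_real (ht w) * x v (Suc i)))" by simp
    then have ae: "of_real (a v) * e w - of_real (a w) * e v = of_real (ht v) * s w - of_real (ht w) * s v"
      by (simp add: e_def s_def poly_functional_def sum_distrib_left sum_subtractf algebra_simps)
    have "s v = z * e v + k * of_real (a v) + l * of_real (ht v)"
      "s w = z * e w + k * of_real (a w) + l * of_real (ht w)"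
      using kl[of v] kl[of w] arcs_V[OF vw] by (simp_all add: algebra_simps)
    with ae show "A v * E w = A w * E v" by (simp add: A_def E_def algebra_simps)
  next
    show "\<exists>v\<in>V. A v \<noteq> 0"
    proof (rule ccontr)
      assume "\<not> ?thesis"
      then have "complex_of_real (a v) = z * of_real (ht v)" if "v \<in> V" for v using that by (simp add: A_def)
      then have "Re (complex_of_real (a v)) = Re (z * of_real (ht v))" if "v \<in> V" for v using that by metis
      then show False using a by auto
    qed
  next
    show "\<not> (\<exists>m. \<forall>v\<in>V. E v = m * A v)"
    proof
      assume "\<exists>m. \<forall>v\<in>V. E v = m * A v"
      then obtain m where "\<forall>v\<in>V. E v = m * A v" by blast
      then have "e v = m * of_real (a v) + (- m * z - k) * of_real (ht v)" if "v \<in> V" for v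
        using that by (simp add: A_def E_def algebra_simps)
      then show False using nP unfolding P_def e_def by blast
    qed
  qed
  then obtain W1 W2 where W: "separated \<Gamma> W1 W2" "\<And>v. v \<in> V - (W1 \<union> W2) \<Longrightarrow> A v = 0" by blast
  obtain u where u: "u \<in> V - (W1 \<union> W2)" "ht u \<noteq> 0" using separated_outside_support[OF W(1)] by blast
  have z: "z = of_real (a u / ht u)" using W(2)[OF u(1)] u(2) by (simp add: A_def field_simps)
  have "a v = a u / ht u * ht v" if "v \<in> V - (W1 \<union> W2)" for v
  proof -
    have "complex_of_real (a v) = complex_of_real (a u / ht u * ht v)"
      using W(2)[OF that] unfolding A_def z by simp
    then show ?thesis by (simp only: of_real_eq_iff)
  qed
  then show ?thesis using W(1) by blast
qed

end


section \<open>The two inclusions\<close>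

context raag_epi
begin

lemma coord_subspace_eq:
  assumes "W \<subseteq> V"
  shows "cohomology_map N 1 (\<lambda>x. x) ` coord_subspace \<Gamma> W =
    {hom_class N (lin \<Gamma> c) |c. \<forall>v\<in>V - W. c v = 0}"
proof -
  have map: "cohomology_map N 1 (\<lambda>x. x) (hom_class G \<phi>) = hom_class N \<phi>" for \<phi>
    by (rule cohomology_map_hom_class) (auto simp: carrier_N)
  have lin: "(\<lambda>g. \<Sum>v\<in>W. c v * vertex_dual v g) = lin \<Gamma> (\<lambda>v. if v \<in> W then c v else 0)" for c
    unfolding lin_def using assms finite_V
    by (intro ext sum.mono_neutral_cong_left) auto
  show ?thesis
  proof (intro equalityI subsetI)
    fix X assume "X \<in> cohomology_map N 1 (\<lambda>x. x) ` coord_subspace \<Gamma> W"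
    then obtain c where "X = hom_class N (lin \<Gamma> (\<lambda>v. if v \<in> W then c v else 0))"
      unfolding coord_subspace_def lin by (auto simp: map[simplified])
    then show "X \<in> {hom_class N (lin \<Gamma> c) |c. \<forall>v\<in>V - W. c v = 0}" by auto
  next
    fix X assume "X \<in> {hom_class N (lin \<Gamma> c) |c. \<forall>v\<in>V - W. c v = 0}"
    then obtain c where c: "X = hom_class N (lin \<Gamma> c)" "\<forall>v\<in>V - W. c v = 0" by blast
    have "lin \<Gamma> c = lin \<Gamma> (\<lambda>v. if v \<in> W then c v else 0)" using c(2) by (intro ext lin_cong) auto
    then have "X = cohomology_map N 1 (\<lambda>x. x) (hom_class G (\<lambda>g. \<Sum>v\<in>W. c v * vertex_dual v g))"
      using c(1) by (simp only: map lin)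
    then show "X \<in> cohomology_map N 1 (\<lambda>x. x) ` coord_subspace \<Gamma> W"
      unfolding coord_subspace_def by blast
  qed
qed

lemma coord_union_iff:
  "X \<in> (\<Union>W\<in>disconnected_subsets \<Gamma>. cohomology_map N 1 (\<lambda>x. x) ` coord_subspace \<Gamma> W) \<longleftrightarrow>
    (\<exists>W\<in>disconnected_subsets \<Gamma>. \<exists>c. X = hom_class N (lin \<Gamma> c) \<and> (\<forall>v\<in>V - W. c v = 0))"
proof -
  have "W \<subseteq> V" if "W \<in> disconnected_subsets \<Gamma>" for W using that by (simp add: disconnected_subsets_def)
  then show ?thesis
    unfolding UN_iff by (intro bex_cong[OF HOL.refl]) (simp only: coord_subspace_eq mem_Collect_eq)
qed

lemma hom_class_N_eq_iff: "hom_class N \<phi> = hom_class N \<psi> \<longleftrightarrow> (\<forall>x\<in>carrier N. \<phi> x = \<psi> x)"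
  by (simp add: hom_class_eq hom_cochain_eq_iff)

lemma bns1_upper_bound:
  "bns1 N \<subseteq> carrier (group_cohomology N 1) -
    (\<Union>W\<in>disconnected_subsets \<Gamma>. cohomology_map N 1 (\<lambda>x. x) ` coord_subspace \<Gamma> W)"
proof
  fix X assume "X \<in> bns1 N"
  then obtain \<phi> S where X: "X = hom_class N \<phi>" and \<phi>: "\<phi> \<in> hom N real_group"
    and nz: "\<exists>g\<in>carrier N. \<phi> g \<noteq> 0" and S: "finite S" "S \<subseteq> carrier N"
    and conn: "Digraph_Component.connected
      (induce_subgraph (with_proj (cayley_graph N S)) {g \<in> carrier N. \<phi> g \<ge> 0})"
    by (auto simp: bns1_def finite_generating_set_def)
  have "X \<notin> (\<Union>W\<in>disconnected_subsets \<Gamma>. cohomology_map N 1 (\<lambda>x. x) ` coord_subspace \<Gamma> W)"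
  proof
    assume "X \<in> (\<Union>W\<in>disconnected_subsets \<Gamma>. cohomology_map N 1 (\<lambda>x. x) ` coord_subspace \<Gamma> W)"
    then obtain W c where W: "W \<in> disconnected_subsets \<Gamma>" and c: "hom_class N \<phi> = hom_class N (lin \<Gamma> c)"
      and supp: "\<forall>v\<in>V - W. c v = 0" unfolding coord_union_iff X by blast
    have eq: "\<And>x. x \<in> carrier N \<Longrightarrow> \<phi> x = lin \<Gamma> c x" using c by (simp add: hom_class_N_eq_iff)
    obtain a where a: "a \<in> V" "c a \<noteq> 0"
    proof (rule ccontr)
      assume "\<not> thesis"
      then have "\<forall>v\<in>V. c v = 0" using that by blast
      then have "lin \<Gamma> c g = 0" for g by (simp add: lin_def)
      then show False using nz eq by simp
    qed
    then have aW: "a \<in> W" using supp by blast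
    then obtain W1 W2 where sep: "separated \<Gamma> W1 W2" and W12: "W = W1 \<union> W2"
      using disconnected_separated[OF W] by blast
    have set_eq: "{g \<in> carrier N. \<phi> g \<ge> 0} = {g \<in> carrier N. lin \<Gamma> c g \<ge> 0}" using eq by auto
    \<comment> \<open>Stated for either order of the two parts, so that \<open>a\<close> may be
      assumed to lie in the first.\<close>
    have False if "separated \<Gamma> U1 U2" "W = U1 \<union> U2" "a \<in> U1" for U1 U2
    proof -
      have "c v = 0" if "v \<in> V" "v \<notin> U1" "v \<notin> U2" for v using supp that \<open>W = U1 \<union> U2\<close> by blast
      then show False
        using half_space_disconnected[where c = c, OF that(1) _ that(3) a(2) S] conn unfolding set_eq by blast
    qed
    then show False using sep separated_sym[OF sep] W12 aW by blast
  qed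
  then show "X \<in> carrier (group_cohomology N 1) -
      (\<Union>W\<in>disconnected_subsets \<Gamma>. cohomology_map N 1 (\<lambda>x. x) ` coord_subspace \<Gamma> W)"
    using \<phi> unfolding X carrier_cohomology_1[OF group_N] by blast
qed

end

text \<open>If \<open>c\<close> vanishes on one part, the indicator of a vertex of that part serves
  as \<open>b\<close>; otherwise the restriction of \<open>c\<close> to \<open>W1\<close>
  does.\<close>

lemma separated_annihilator:
  assumes sep: "separated \<Gamma> W1 W2" and supp: "\<And>v. v \<in> pverts \<Gamma> \<Longrightarrow> v \<notin> W1 \<union> W2 \<Longrightarrow> c v = (0::real)"
    and arcs: "\<And>v w. (v, w) \<in> parcs \<Gamma> \<Longrightarrow> v \<in> pverts \<Gamma> \<and> w \<in> pverts \<Gamma>"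
  shows "\<exists>b. (\<forall>v\<in>pverts \<Gamma> - (W1 \<union> W2). b v = 0) \<and> (\<forall>(v, w)\<in>parcs \<Gamma>. b v * c w = b w * c v) \<and>
    \<not> (\<exists>k. \<forall>v\<in>pverts \<Gamma>. b v = k * c v)"
proof -
  have zero: ?thesis if sep': "separated \<Gamma> U1 U2" and U: "U1 \<union> U2 = W1 \<union> W2" and c0: "\<forall>v\<in>U1. c v = 0" for U1 U2
  proof -
    obtain u where u: "u \<in> U1" "u \<in> pverts \<Gamma>" using sep' by (auto simp: separated_def)
    define b where "b v = (if v = u then 1 else 0 :: real)" for v
    have nb: "c w = 0" if "(u, w) \<in> parcs \<Gamma> \<or> (w, u) \<in> parcs \<Gamma>" for w
    proof -
      have "w \<in> pverts \<Gamma>" "w \<notin> U2" using that arcs separatedD[OF sep'] u by blast+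
      then show ?thesis using c0 supp U by blast
    qed
    have "\<forall>v\<in>pverts \<Gamma> - (W1 \<union> W2). b v = 0" using u U by (auto simp: b_def)
    moreover have "\<forall>(v, w)\<in>parcs \<Gamma>. b v * c w = b w * c v" using nb by (auto simp: b_def)
    moreover have "\<not> (\<exists>k. \<forall>v\<in>pverts \<Gamma>. b v = k * c v)" using u c0 by (auto simp: b_def)
    ultimately show ?thesis by blast
  qed
  consider "\<forall>v\<in>W1. c v = 0" | "\<forall>v\<in>W2. c v = 0" | v1 v2 where "v1 \<in> W1" "c v1 \<noteq> 0" "v2 \<in> W2" "c v2 \<noteq> 0"
    by blast
  then show ?thesis
  proof cases
    case 1
    then show ?thesis using zero[OF sep] by blast
  next
    case 2
    then show ?thesis using zero[OF separated_sym[OF sep]] by blast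
  next
    case 3
    define b where "b v = (if v \<in> W1 then c v else 0)" for v
    have "b v * c w = b w * c v" if "(v, w) \<in> parcs \<Gamma>" for v w
    proof -
      have "v \<in> W1 \<Longrightarrow> w \<notin> W1 \<Longrightarrow> c w = 0" "w \<in> W1 \<Longrightarrow> v \<notin> W1 \<Longrightarrow> c v = 0"
        using separatedD[OF sep that] supp arcs[OF that] by blast+
      then show ?thesis by (auto simp: b_def)
    qed
    moreover have "\<not> (\<exists>k. \<forall>v\<in>pverts \<Gamma>. b v = k * c v)"
    proof
      assume "\<exists>k. \<forall>v\<in>pverts \<Gamma>. b v = k * c v"
      then obtain k where k: "\<And>v. v \<in> pverts \<Gamma> \<Longrightarrow> b v = k * c v" by blast
      have "v1 \<in> pverts \<Gamma>" "v2 \<in> pverts \<Gamma>" "v2 \<notin> W1" using sep 3 by (auto simp: separated_def)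
      then have "c v1 = k * c v1" "0 = k * c v2" using k[of v1] k[of v2] 3 by (auto simp: b_def)
      then show False using 3 by simp
    qed
    moreover have "\<forall>v\<in>pverts \<Gamma> - (W1 \<union> W2). b v = 0" by (auto simp: b_def)
    ultimately show ?thesis by (intro exI[of _ b]) auto
  qed
qed

section \<open>Classes in the coordinate subspaces are resonant\<close>

context raag_epi_trivial_H1
begin

lemma coord_union_resonant:
  assumes card: "card V > 1" and W: "W \<in> disconnected_subsets \<Gamma>" and supp: "\<forall>v\<in>V - W. c v = 0"
  shows "hom_class N (lin \<Gamma> c) \<in> resonance11 N"
proof -
  have "\<exists>b. wedge_rel b c (\<lambda>v. 0) \<and> \<not> (\<exists>k l. \<forall>v\<in>V. b v = k * c v + l * ht v)"
  proof (cases "W = {}")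
    case True
    then have c0: "\<And>v. v \<in> V \<Longrightarrow> c v = 0" using supp by blast
    have wedge: "wedge_rel b c (\<lambda>v. 0)" for b using c0 arcs_V by (auto simp: wedge_rel_def)
    \<comment> \<open>For the zero class any \<open>b\<close> not proportional to \<chi> will do;
      the indicators of two distinct vertices cannot both be multiples of the height.\<close>
    obtain u w where uw: "u \<in> V" "w \<in> V" "u \<noteq> w"
      using card by (metis card_le_Suc0_iff_eq finite_V not_less One_nat_def)
    define b where "b z v = (if v = z then 1 else 0 :: real)" for z v :: 'a
    have "\<not> (\<exists>k l. \<forall>v\<in>V. b u v = k * c v + l * ht v) \<or> \<not> (\<exists>k l. \<forall>v\<in>V. b w v = k * c v + l * ht v)"
    proof (rule ccontr)
      assume "\<not> ?thesis"
      then obtain l m where "\<forall>v\<in>V. b u v = l * ht v" "\<forall>v\<in>V. b w v = m * ht v" using c0 by auto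
      then have "l * ht u = 1" "l * ht w = 0" "m * ht w = 1" using uw by (auto simp: b_def)
      then show False by auto
    qed
    then show ?thesis using wedge by blast
  next
    case False
    then obtain W1 W2 where sep: "separated \<Gamma> W1 W2" and W12: "W = W1 \<union> W2"
      using disconnected_separated[OF W] by blast
    obtain b where b: "\<forall>v\<in>V - (W1 \<union> W2). b v = 0" "\<forall>(v, w)\<in>parcs \<Gamma>. b v * c w = b w * c v"
      "\<not> (\<exists>k. \<forall>v\<in>V. b v = k * c v)"
      using separated_annihilator[OF sep, of c] supp W12 arcs_V by blast
    obtain u where u: "u \<in> V - (W1 \<union> W2)" "ht u \<noteq> 0" using separated_outside_support[OF sep] by blast
    have "\<not> (\<exists>k l. \<forall>v\<in>V. b v = k * c v + l * ht v)"
    proof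
      assume "\<exists>k l. \<forall>v\<in>V. b v = k * c v + l * ht v"
      then obtain k l where kl: "\<forall>v\<in>V. b v = k * c v + l * ht v" by blast
      \<comment> \<open>At \<open>u\<close> only the height survives, which rules out a multiple of
        it in the combination.\<close>
      have "b u = 0" "c u = 0" using b(1) supp W12 u by blast+
      then have "l = 0" using kl u by force
      then show False using kl b(3) by auto
    qed
    moreover have "wedge_rel b c (\<lambda>v. 0)" using b(2) by (auto simp: wedge_rel_def)
    ultimately show ?thesis by blast
  qed
  then obtain b where b: "wedge_rel b c (\<lambda>v. 0)" "\<not> (\<exists>k l. \<forall>v\<in>V. b v = k * c v + l * ht v)" by blast
  have "\<not> (\<exists>k. \<forall>x\<in>carrier N. lin \<Gamma> b x = k * lin \<Gamma> c x)"
  proof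
    assume "\<exists>k. \<forall>x\<in>carrier N. lin \<Gamma> b x = k * lin \<Gamma> c x"
    then obtain k where "\<forall>x\<in>carrier N. lin \<Gamma> b x = lin \<Gamma> (\<lambda>v. k * c v + 0 * c v) x"
      unfolding lin_lincomb by auto
    then show False using b(2) unfolding lin_eq_on_N_iff by auto
  qed
  then show ?thesis
    unfolding resonance11_iff[OF group_N lin_hom_N]
    using wedge_rel_cup_trivial[OF b(1)] lin_hom_N by blast
qed

end

section \<open>Resonant classes lie in the coordinate subspaces\<close>

context raag_epi_trivial_H2
begin

text \<open>A multiple of the height restricts to the zero class, supplied by the empty set.
  Otherwise \<open>resonant_support\<close> gives a multiple of the height whose subtraction leaves
  the restriction to \<open>N\<close> unchanged and moves the support into a disconnected
  set.\<close>

lemma resonant_coord_union: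
  assumes "hom_class N (lin \<Gamma> a) \<in> resonance11 N"
  shows "\<exists>W\<in>disconnected_subsets \<Gamma>. \<exists>c. hom_class N (lin \<Gamma> a) = hom_class N (lin \<Gamma> c) \<and> (\<forall>v\<in>V - W. c v = 0)"
proof (cases "\<exists>k. \<forall>v\<in>V. a v = k * ht v")
  case True
  then have "hom_class N (lin \<Gamma> a) = hom_class N (lin \<Gamma> (\<lambda>v. 0))"
    by (simp add: hom_class_N_eq_iff lin_eq_on_N_iff)
  then show ?thesis using empty_disconnected by blast
next
  case False
  obtain \<phi> where \<phi>: "\<phi> \<in> hom N real_group" "cup_trivial N \<phi> (lin \<Gamma> a)"
    "\<not> (\<exists>k. \<forall>x\<in>carrier N. \<phi> x = k * lin \<Gamma> a x)"
    using assms unfolding resonance11_iff[OF group_N lin_hom_N] by blast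
  obtain b where b: "\<And>x. x \<in> carrier N \<Longrightarrow> \<phi> x = lin \<Gamma> b x" using hom_extends[OF \<phi>(1)] by blast
  have cup: "cup_trivial N (lin \<Gamma> b) (lin \<Gamma> a)" using \<phi>(2) b by (simp add: cup_trivial_def)
  have "\<not> (\<exists>k l. \<forall>v\<in>V. b v = k * a v + l * ht v)"
  proof
    assume "\<exists>k l. \<forall>v\<in>V. b v = k * a v + l * ht v"
    then obtain k l where "\<forall>v\<in>V. b v = (k * a v + 0 * a v) + l * ht v" by auto
    then have "\<forall>x\<in>carrier N. lin \<Gamma> b x = lin \<Gamma> (\<lambda>v. k * a v + 0 * a v) x"
      unfolding lin_eq_on_N_iff by blast
    then show False using \<phi>(3) b unfolding lin_lincomb by auto
  qed
  then obtain W1 W2 k where W: "separated \<Gamma> W1 W2" "\<forall>v\<in>V - (W1 \<union> W2). a v = k * ht v"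
    using resonant_support[OF cup False] by blast
  have "hom_class N (lin \<Gamma> a) = hom_class N (lin \<Gamma> (\<lambda>v. a v - k * ht v))"
    unfolding hom_class_N_eq_iff lin_eq_on_N_iff by (intro exI[of _ k]) simp
  then show ?thesis using separated_disconnected[OF W(1)] W(2)
    by (intro bexI[of _ "W1 \<union> W2"] exI[of _ "\<lambda>v. a v - k * ht v"]) auto
qed

lemma coord_union_eq_resonance:
  assumes "card V > 1"
  shows "carrier (group_cohomology N 1) -
      (\<Union>W\<in>disconnected_subsets \<Gamma>. cohomology_map N 1 (\<lambda>x. x) ` coord_subspace \<Gamma> W) =
    carrier (group_cohomology N 1) - resonance11 N"
proof -
  have "X \<in> (\<Union>W\<in>disconnected_subsets \<Gamma>. cohomology_map N 1 (\<lambda>x. x) ` coord_subspace \<Gamma> W) \<longleftrightarrow>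
      X \<in> resonance11 N" if X: "X \<in> carrier (group_cohomology N 1)" for X
  proof -
    obtain \<phi> where \<phi>: "\<phi> \<in> hom N real_group" "X = hom_class N \<phi>"
      using X unfolding carrier_cohomology_1[OF group_N] by blast
    obtain a where "\<And>x. x \<in> carrier N \<Longrightarrow> \<phi> x = lin \<Gamma> a x" using hom_extends[OF \<phi>(1)] by blast
    then have a: "X = hom_class N (lin \<Gamma> a)" by (simp add: \<phi>(2) hom_class_N_eq_iff)
    show ?thesis
      unfolding coord_union_iff
    proof
      assume "\<exists>W\<in>disconnected_subsets \<Gamma>. \<exists>c. X = hom_class N (lin \<Gamma> c) \<and> (\<forall>v\<in>V - W. c v = 0)"
      then show "X \<in> resonance11 N" using coord_union_resonant[OF assms] by auto
    next
      assume "X \<in> resonance11 N"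
      then show "\<exists>W\<in>disconnected_subsets \<Gamma>. \<exists>c. X = hom_class N (lin \<Gamma> c) \<and> (\<forall>v\<in>V - W. c v = 0)"
        using resonant_coord_union unfolding a by simp
    qed
  qed
  moreover have "(\<And>X. X \<in> A \<Longrightarrow> X \<in> U \<longleftrightarrow> X \<in> R) \<Longrightarrow> A - U = A - R" for A U R :: "'b set" by auto
  ultimately show ?thesis by blast
qed

end

theorem theorem15p8:
  fixes \<Gamma> :: "'v pair_pre_digraph"
    and \<chi> :: "'v word set \<Rightarrow> int"
  assumes "pair_graph \<Gamma>"
    and "card (pverts \<Gamma>) > 1"
    and "\<chi> \<in> epi (raag \<Gamma>) integer_group"
    and "trivial_conj_action (raag \<Gamma>) (kernel (raag \<Gamma>) integer_group \<chi>) 1"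
  shows "bns1 (kernel_group (raag \<Gamma>) \<chi>) \<subseteq>
           carrier (group_cohomology (kernel_group (raag \<Gamma>) \<chi>) 1) -
           (\<Union>W\<in>disconnected_subsets \<Gamma>.
              cohomology_map (kernel_group (raag \<Gamma>) \<chi>) 1 (\<lambda>x. x) ` coord_subspace \<Gamma> W)
       \<and> (trivial_conj_action (raag \<Gamma>) (kernel (raag \<Gamma>) integer_group \<chi>) 2 \<longrightarrow>
           carrier (group_cohomology (kernel_group (raag \<Gamma>) \<chi>) 1) -
           (\<Union>W\<in>disconnected_subsets \<Gamma>.
              cohomology_map (kernel_group (raag \<Gamma>) \<chi>) 1 (\<lambda>x. x) ` coord_subspace \<Gamma> W)
           = carrier (group_cohomology (kernel_group (raag \<Gamma>) \<chi>) 1) -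
             resonance11 (kernel_group (raag \<Gamma>) \<chi>))"
proof -
  interpret raag_epi_trivial_H1 \<Gamma> \<chi>
    using assms by (simp add: raag_epi_trivial_H1_def raag_epi_trivial_H1_axioms_def raag_epi_def)
  have "raag_epi_trivial_H2 \<Gamma> \<chi>" if "trivial_conj_action (raag \<Gamma>) (kernel (raag \<Gamma>) integer_group \<chi>) 2"
    by (intro raag_epi_trivial_H2.intro raag_epi_trivial_H2_axioms.intro raag_epi_trivial_H1_axioms that)
  then show ?thesis
    using bns1_upper_bound raag_epi_trivial_H2.coord_union_eq_resonance[OF _ assms(2)] by (intro conjI impI) simp_all
qed

end
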